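(* Let $W^{H}$ be a (continuous) fractional Brownian field on $\mathbb{R}^{n}$ with Hurst parameter $H=(H_{1},\dots,H_{n})\in(0,1)^n$, and set $$h^H(x,y)=\prod_{k=1}^n |x_k-y_k|^{H_k}\left|\log \prod_{j=1}^n|x_j-y_j|\right|^{1/2}.$$ Then, for any $\delta>0$, the following inequality holds almost surely: $$\sup_{|x-y|\le\delta}\frac{|\square_y^nW^H(x)|}{h^H(x,y)}\le c_{n,\delta}$$ for some finite random variable $c_{n,\delta}$ depending on $n$ and $\delta$ such that $\mathbb{E}\,e^{c_{n,\delta}^2}<\infty$. Moreover, there is a constant $\kappa_n$ such that $$\lim_{\delta\downarrow0}\ \sup_{|x-y|\le \delta}\frac{|\square_y^nW^H(x)|}{h^H(x,y)}\le \kappa_n$$ almost surely. In both suprema $x,y$ range over $[0,1]^n$.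
   Context: A fractional Brownian field $W^H$ with Hurst parameter $H=(H_1,\dots,H_n)$ is a centered Gaussian random field on $\mathbb{R}^n$ with covariance $\mathbb{E}[W^H(x)W^H(y)]=\prod_{k=1}^nR_k(x_k,y_k)$, where $R_k(s,t)=\frac12\left[|s|^{2H_k}+|t|^{2H_k}-|s-t|^{2H_k}\right]$ for $s,t\in\mathbb{R}$. For $x,y\in\mathbb{R}^n$, put $V_{k,y}x=(x_1,\dots,x_{k-1},y_k,x_{k+1},\dots,x_n)$ and, for a function $f$ on $\mathbb{R}^n$, $V_{k,y}f(x)=f(V_{k,y}x)$. The joint (rectangular) increment of $f$ is $\square_y^n f(x)=\prod_{k=1}^n (I-V_{k,y})f(x)$, where $I$ is the identity operator (the $V_{k,y}$ commute); for a random field it is applied pathwise. Quotients $0/0$ are read as $0$.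
   Formalization: The finite c_{n,δ} is claimed only for δ<√n, and E exp(c²)<∞ only if (δ/√n)^n<e^{-2} (otherwise E exp(αc²)<∞ for some α>0); the claim fails for all other δ. κ_n is stated for fields on probability spaces over one (arbitrary) underlying set. *)

theory Defs
  imports "HOL-Probability.Probability"
begin

text \<open>Gaussian random variables, where almost surely constant ones count as Gaussian of variance 0.\<close>

definition gaussian_rv :: "'a measure \<Rightarrow> ('a \<Rightarrow> real) \<Rightarrow> bool" where
  "gaussian_rv M X \<longleftrightarrow> X \<in> borel_measurable M \<and>
     ((\<exists>\<mu> \<sigma>. \<sigma> > 0 \<and> distributed M lborel X (\<lambda>x. ennreal (normal_density \<mu> \<sigma> x))) \<or>
      (\<exists>\<mu>. AE \<omega> in M. X \<omega> = \<mu>))"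

text \<open>The finite-dimensional distributions are jointly Gaussian: every finite linear combination
  is a Gaussian random variable.\<close>

definition gaussian_field :: "'a measure \<Rightarrow> ('i \<Rightarrow> 'a \<Rightarrow> real) \<Rightarrow> bool" where
  "gaussian_field M W \<longleftrightarrow>
     (\<forall>I a. finite I \<longrightarrow> gaussian_rv M (\<lambda>\<omega>. \<Sum>i\<in>I. a i * W i \<omega>))"

definition fbm_cov :: "real \<Rightarrow> real \<Rightarrow> real \<Rightarrow> real" where
  "fbm_cov h s t = (\<bar>s\<bar> powr (2 * h) + \<bar>t\<bar> powr (2 * h) - \<bar>s - t\<bar> powr (2 * h)) / 2"

text \<open>Continuity is only required of almost every sample path.\<close>

definition continuous_fbf ::
  "'a measure \<Rightarrow> real ^ 'n \<Rightarrow> (real ^ 'n \<Rightarrow> 'a \<Rightarrow> real) \<Rightarrow> bool" where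
  "continuous_fbf M H W \<longleftrightarrow>
     prob_space M \<and>
     gaussian_field M W \<and>
     (\<forall>x. prob_space.expectation M (W x) = 0) \<and>
     (\<forall>x y. prob_space.expectation M (\<lambda>\<omega>. W x \<omega> * W y \<omega>)
              = (\<Prod>k\<in>UNIV. fbm_cov (H $ k) (x $ k) (y $ k))) \<and>
     (AE \<omega> in M. continuous_on UNIV (\<lambda>x. W x \<omega>))"

definition replace_coord :: "'n \<Rightarrow> real ^ 'n \<Rightarrow> real ^ 'n \<Rightarrow> real ^ 'n" where
  "replace_coord k y x = (\<chi> i. if i = k then y $ k else x $ i)"

definition coord_increment ::
  "real ^ 'n \<Rightarrow> 'n \<Rightarrow> (real ^ 'n \<Rightarrow> real) \<Rightarrow> (real ^ 'n \<Rightarrow> real)" where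
  "coord_increment y k f = (\<lambda>x. f x - f (replace_coord k y x))"

lemma comp_fun_commute_coord_increment: "comp_fun_commute (coord_increment y)"
proof
  fix j k
  have "replace_coord j y (replace_coord k y x) = replace_coord k y (replace_coord j y x)" for x
    by (auto simp: replace_coord_def vec_eq_iff)
  then show "coord_increment y k \<circ> coord_increment y j
           = coord_increment y j \<circ> coord_increment y k"
    by (auto simp: fun_eq_iff coord_increment_def)
qed

text \<open>The composition of the operators \<open>I - V\<^sub>k\<^sub>,\<^sub>y\<close> over all coordinates \<open>k\<close>; they commute by the
  preceding lemma, so the fold does not depend on an order of the coordinates.\<close>

definition rect_increment ::
  "real ^ 'n \<Rightarrow> (real ^ 'n \<Rightarrow> real) \<Rightarrow> (real ^ 'n \<Rightarrow> real)" where
  "rect_increment y f = Finite_Set.fold (coord_increment y) f UNIV"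

text \<open>If \<open>x\<close> and \<open>y\<close> share a coordinate, the first product is 0 and so is \<open>modulus H x y\<close>
  (\<open>ln 0 = 0\<close> in HOL, in place of the convention \<open>0 * \<infinity> = 0\<close>).\<close>

definition modulus :: "real ^ 'n \<Rightarrow> real ^ 'n \<Rightarrow> real ^ 'n \<Rightarrow> real" where
  "modulus H x y = (\<Prod>k\<in>UNIV. \<bar>x $ k - y $ k\<bar> powr (H $ k)) *
                   sqrt \<bar>ln (\<Prod>j\<in>UNIV. \<bar>x $ j - y $ j\<bar>)\<bar>"

text \<open>The quotient is taken in \<^typ>\<open>ereal\<close>, where \<open>0 / 0 = 0\<close> and \<open>a / 0 = \<infinity>\<close> for \<open>a > 0\<close>.\<close>

definition increment_ratio_sup ::
  "real ^ 'n \<Rightarrow> (real ^ 'n \<Rightarrow> real) \<Rightarrow> real \<Rightarrow> ereal" where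
  "increment_ratio_sup H f \<delta> =
     (SUP (x, y) \<in> {(x, y). x \<in> cbox 0 1 \<and> y \<in> cbox 0 1 \<and> norm (x - y) \<le> \<delta>}.
        ereal \<bar>rect_increment y f x\<bar> / ereal (modulus H x y))"

end

theory Submission
  imports Defs
begin

text \<open>
  Divide the increment over a box with sides \<open>d\<^sub>k = \<bar>x\<^sub>k - y\<^sub>k\<bar>\<close> by its Hurst volume, the product of the
  \<open>d\<^sub>k powr H\<^sub>k\<close>. The covariance factorises over the coordinates, so the quotient is a standard
  Gaussian whenever no \<open>d\<^sub>k\<close> vanishes (\<open>normalized_rect_increment\<close>). For fixed shape, boxes with
  sides of order \<open>2 powr - m\<^sub>k\<close> can be represented by about \<open>2 ^ (\<Sum>k. m\<^sub>k)\<close> grid boxes, up to a fixed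
  power, while the logarithm in the modulus is at least \<open>L\<^sub>m = max L\<^sub>0 (ln 2 * (\<Sum>k. m\<^sub>k))\<close>, where
  \<open>exp (- L\<^sub>0)\<close> bounds the volumes of all boxes considered. Hence the Gaussian tail at height
  \<open>u * sqrt L\<^sub>m\<close> beats the number of boxes once \<open>u\<close> exceeds an absolute constant, and all shapes can
  be handled by one union bound.

  The union bound \<open>gaussian_family_bound\<close> is carried out on exponential moments: with \<open>\<xi>\<^sub>i\<close> standard
  Gaussian, the random series of the \<open>exp (\<theta>/2 * (\<xi>\<^sub>i\<^sup>2 - u\<^sup>2 * L\<^sub>i))\<close> has finite mean for every
  \<open>\<theta> < 1\<close> when \<open>u\<close> is large. Its logarithm bounds all \<open>\<xi>\<^sub>i\<^sup>2 / L\<^sub>i\<close> at once, by a variable \<open>G\<^sup>2\<close>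
  with \<open>exp (\<alpha> * G\<^sup>2)\<close> integrable for \<open>2 * \<alpha> \<le> \<theta> * L\<^sub>0\<close>. As \<open>1 / L\<^sub>0\<close> is the largest variance, this
  is Fernique's theorem with every exponent below the critical one, and it is what makes the exponent
  \<open>1\<close> admissible as soon as \<open>L\<^sub>0 > 2\<close>. Because the series converges, only finitely many
  of the \<open>\<xi>\<^sub>i\<^sup>2\<close> exceed \<open>u\<^sup>2 * L\<^sub>i\<close>; this yields an almost sure limit bound independent of \<open>H\<close>.

  Passing from grid boxes to arbitrary boxes must not spoil these constants. A box of shape \<open>m\<close> is
  therefore rounded inwards to the mesh \<open>2 powr - (m\<^sub>k + r)\<close>, which can only shrink its Hurst volume,
  and the rest is a signed sum of boxes with one side shorter by the factor \<open>2 powr - r\<close>. By chaining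
  along dyadic intervals, one coordinate after the other (\<open>rect_increment_chaining\<close>), the rest is at
  most \<open>\<epsilon>\<^sub>r * \<Gamma>\<close> times the modulus, with \<open>\<epsilon>\<^sub>r \<longlonglongrightarrow> 0\<close> and \<open>\<Gamma>\<close> a bound of the type above on the
  dyadic boxes (\<open>increment_ratio_sup_grid_bound\<close>). So the ratio is at most \<open>G + \<epsilon>\<^sub>r * \<Gamma>\<close>, where
  \<open>\<epsilon>\<^sub>r * \<Gamma>\<close> costs nothing: \<open>r\<close> is chosen deterministically for the moment bound, and depending on the
  sample path for the limit.
\<close>

section \<open>Exponential moments of countable Gaussian families\<close>

lemma gaussian_rv_integrable:
  assumes "prob_space M" "gaussian_rv M X"
  shows "integrable M X" "integrable M (\<lambda>\<omega>. (X \<omega>)\<^sup>2)"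
proof -
  interpret prob_space M by fact
  have meas [measurable]: "X \<in> borel_measurable M"
    using assms(2) by (simp add: gaussian_rv_def)
  have "integrable M X \<and> integrable M (\<lambda>\<omega>. (X \<omega>)\<^sup>2)"
  proof (cases "\<exists>\<mu>. AE \<omega> in M. X \<omega> = \<mu>")
    case True
    then obtain \<mu> where \<mu>: "AE \<omega> in M. X \<omega> = \<mu>" by blast
    have "integrable M X"
      by (rule integrable_cong_AE_imp[of M "\<lambda>_. \<mu>"]) (use \<mu> in auto)
    moreover have "integrable M (\<lambda>\<omega>. (X \<omega>)\<^sup>2)"
      by (rule integrable_cong_AE_imp[of M "\<lambda>_. \<mu>\<^sup>2"]) (use \<mu> in auto)
    ultimately show ?thesis by blast
  next
    case False
    then obtain \<mu> \<sigma> where \<sigma>: "\<sigma> > 0"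
      and D: "distributed M lborel X (\<lambda>x. ennreal (normal_density \<mu> \<sigma> x))"
      using assms(2) unfolding gaussian_rv_def by blast
    have 1: "integrable lborel (\<lambda>x. normal_density \<mu> \<sigma> x * x)"
      using \<sigma> by (rule integrable_normal_moment_nz_1)
    have "integrable lborel (\<lambda>x. normal_density \<mu> \<sigma> x * (x - \<mu>)^2
             + 2 * \<mu> * (normal_density \<mu> \<sigma> x * x) - \<mu>\<^sup>2 * normal_density \<mu> \<sigma> x)"
      using \<sigma> 1 by (intro Bochner_Integration.integrable_add Bochner_Integration.integrable_diff
            integrable_mult_right integrable_normal_moment integrable_normal_density)
    also have "(\<lambda>x. normal_density \<mu> \<sigma> x * (x - \<mu>)^2
             + 2 * \<mu> * (normal_density \<mu> \<sigma> x * x) - \<mu>\<^sup>2 * normal_density \<mu> \<sigma> x)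
        = (\<lambda>x. normal_density \<mu> \<sigma> x * x\<^sup>2)"
      by (auto simp: fun_eq_iff power2_eq_square algebra_simps)
    finally have 2: "integrable lborel (\<lambda>x. normal_density \<mu> \<sigma> x * x\<^sup>2)" .
    show ?thesis
      using distributed_integrable[OF D, of "\<lambda>x. x"] distributed_integrable[OF D, of "\<lambda>x. x\<^sup>2"] 1 2
      by simp
  qed
  then show "integrable M X" "integrable M (\<lambda>\<omega>. (X \<omega>)\<^sup>2)" by blast+
qed

text \<open>Since \<open>exp (\<theta> x\<^sup>2 / 2)\<close> times the standard normal density is a constant multiple of the normal
  density with variance \<open>1 / (1 - \<theta>)\<close>, the constant is the moment.\<close>

lemma gaussian_rv_exp_square:
  assumes "prob_space M" "gaussian_rv M X"
    and mean: "prob_space.expectation M X = 0"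
    and var: "prob_space.expectation M (\<lambda>\<omega>. (X \<omega>)\<^sup>2) = 1"
    and \<theta>: "0 \<le> \<theta>" "\<theta> < 1"
  shows "(\<integral>\<^sup>+\<omega>. ennreal (exp (\<theta> / 2 * (X \<omega>)\<^sup>2)) \<partial>M) = ennreal (1 / sqrt (1 - \<theta>))"
proof -
  interpret prob_space M by fact
  have meas [measurable]: "X \<in> borel_measurable M"
    using assms(2) by (simp add: gaussian_rv_def)
  have "\<not> (AE \<omega> in M. X \<omega> = \<mu>)" for \<mu>
  proof
    assume \<mu>: "AE \<omega> in M. X \<omega> = \<mu>"
    have "expectation X = (\<integral>\<omega>. \<mu> \<partial>M)" by (intro integral_cong_AE) (use \<mu> in auto)
    then have "\<mu> = 0" using mean by (simp add: prob_space)
    moreover have "expectation (\<lambda>\<omega>. (X \<omega>)\<^sup>2) = (\<integral>\<omega>. \<mu>\<^sup>2 \<partial>M)"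
      by (intro integral_cong_AE) (use \<mu> in auto)
    ultimately show False using var by simp
  qed
  then obtain \<mu> \<sigma> where \<sigma>: "\<sigma> > 0"
    and D: "distributed M lborel X (\<lambda>x. ennreal (normal_density \<mu> \<sigma> x))"
    using assms(2) unfolding gaussian_rv_def by blast
  have "\<mu> = 0" using normal_distributed_expectation[OF \<sigma> D] mean by simp
  moreover have "\<sigma>\<^sup>2 = 1" using normal_distributed_variance[OF \<sigma> D] mean var by simp
  then have "\<sigma> = 1" using \<sigma> by (simp add: power2_eq_1_iff)
  ultimately have D: "distributed M lborel X (\<lambda>x. ennreal (std_normal_density x))"
    using D by simp
  define s where "s = 1 / sqrt (1 - \<theta>)"
  have s: "s > 0" "s\<^sup>2 = 1 / (1 - \<theta>)" using \<theta> by (auto simp: s_def power_divide)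
  have dens: "std_normal_density x * exp (\<theta> / 2 * x\<^sup>2) = s * normal_density 0 s x" for x
  proof -
    have "sqrt (2 * pi * s\<^sup>2) = sqrt (2 * pi) * s" using s(1) unfolding real_sqrt_mult by simp
    moreover have "- x\<^sup>2 / 2 + \<theta> / 2 * x\<^sup>2 = - x\<^sup>2 / (2 * s\<^sup>2)"
      using \<theta> unfolding s(2) by (simp add: field_simps)
    ultimately show ?thesis
      using s unfolding normal_density_def by (simp add: mult_exp_exp)
  qed
  have "(\<integral>\<^sup>+\<omega>. ennreal (exp (\<theta> / 2 * (X \<omega>)\<^sup>2)) \<partial>M)
      = (\<integral>\<^sup>+x. ennreal (std_normal_density x) * ennreal (exp (\<theta> / 2 * x\<^sup>2)) \<partial>lborel)"
    by (intro distributed_nn_integral[OF D, symmetric]) simp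
  also have "\<dots> = (\<integral>\<^sup>+x. ennreal s * ennreal (normal_density 0 s x) \<partial>lborel)"
    using s(1) dens
    by (intro nn_integral_cong) (metis ennreal_mult' exp_ge_zero less_imp_le mult.commute)
  also have "\<dots> = ennreal s * (\<integral>\<^sup>+x. ennreal (normal_density 0 s x) \<partial>lborel)"
    by (intro nn_integral_cmult) simp
  also have "(\<integral>\<^sup>+x. ennreal (normal_density 0 s x) \<partial>lborel) = 1"
    using s by (subst nn_integral_eq_integral) auto
  finally show ?thesis by (simp add: s_def)
qed

lemma borel_measurable_nn_integral_count_space:
  fixes f :: "'i \<Rightarrow> 'a \<Rightarrow> ennreal"
  assumes "countable I" and [measurable]: "\<And>i. i \<in> I \<Longrightarrow> f i \<in> borel_measurable M"
  shows "(\<lambda>\<omega>. \<integral>\<^sup>+i. f i \<omega> \<partial>count_space I) \<in> borel_measurable M"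
proof (cases "finite I")
  case True
  then show ?thesis by (simp add: nn_integral_count_space_finite)
next
  case False
  note bij = bij_betw_from_nat_into[OF assms(1) False]
  have "(\<integral>\<^sup>+i. f i \<omega> \<partial>count_space I) = (\<Sum>n. f (from_nat_into I n) \<omega>)" for \<omega>
    by (simp add: nn_integral_bij_count_space[OF bij, symmetric] nn_integral_count_space_nat)
  moreover have "from_nat_into I n \<in> I" for n
    using False by (metis from_nat_into finite.emptyI)
  ultimately show ?thesis by simp
qed

text \<open>The union bound. Writing \<open>u\<^sup>2 = 2 t / \<theta>\<close>, the series \<open>Q\<close> of the \<open>exp (\<theta>/2 * (\<xi>\<^sub>i\<^sup>2 - u\<^sup>2 L\<^sub>i))\<close> has
  mean \<open>(\<Sum>i. exp (- t L\<^sub>i)) / sqrt (1 - \<theta>)\<close>. Each summand is at most \<open>Q\<close>, so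
  \<open>\<xi>\<^sub>i\<^sup>2 \<le> u\<^sup>2 L\<^sub>i + 2/\<theta> * ln Q\<close>, and \<open>L\<^sub>0 \<le> L\<^sub>i\<close> turns this into \<open>G\<^sup>2 L\<^sub>i\<close> for
  \<open>G\<^sup>2 = u\<^sup>2 + 2 / (\<theta> L\<^sub>0) * ln (1 + Q)\<close>. Then \<open>exp (\<alpha> G\<^sup>2)\<close> is a constant times
  \<open>(1 + Q) powr (2 \<alpha> / (\<theta> L\<^sub>0))\<close>, integrable when the exponent is at most \<open>1\<close>. Indices with
  \<open>\<xi>\<^sub>i\<^sup>2 > u\<^sup>2 L\<^sub>i\<close> contribute at least \<open>1\<close> each to \<open>Q\<close>, hence there are finitely many.\<close>

lemma gaussian_family_bound:
  fixes \<xi> :: "'i \<Rightarrow> 'a \<Rightarrow> real" and L :: "'i \<Rightarrow> real"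
  assumes "countable I" "prob_space M"
    and gauss: "\<And>i. i \<in> I \<Longrightarrow> gaussian_rv M (\<xi> i)"
    and mean: "\<And>i. i \<in> I \<Longrightarrow> prob_space.expectation M (\<xi> i) = 0"
    and var: "\<And>i. i \<in> I \<Longrightarrow> prob_space.expectation M (\<lambda>\<omega>. (\<xi> i \<omega>)\<^sup>2) = 1"
    and L0: "0 < L\<^sub>0" and L: "\<And>i. i \<in> I \<Longrightarrow> L\<^sub>0 \<le> L i"
    and t: "0 \<le> t" and summ: "integrable (count_space I) (\<lambda>i. exp (- t * L i))"
    and \<theta>: "0 < \<theta>" "\<theta> < 1"
  obtains G where "G \<in> borel_measurable M" "\<And>\<omega>. 0 \<le> G \<omega>"
    and "AE \<omega> in M. \<forall>i\<in>I. \<bar>\<xi> i \<omega>\<bar> \<le> G \<omega> * sqrt (L i)"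
    and "AE \<omega> in M. finite {i\<in>I. sqrt (2 * t / \<theta>) * sqrt (L i) < \<bar>\<xi> i \<omega>\<bar>}"
    and "\<And>\<alpha>. 0 \<le> \<alpha> \<Longrightarrow> 2 * \<alpha> \<le> \<theta> * L\<^sub>0 \<Longrightarrow> integrable M (\<lambda>\<omega>. exp (\<alpha> * (G \<omega>)\<^sup>2))"
proof -
  interpret prob_space M by fact
  have meas [measurable]: "\<xi> i \<in> borel_measurable M" if "i \<in> I" for i
    using gauss[OF that] by (simp add: gaussian_rv_def)
  define q where "q i \<omega> = exp (\<theta> / 2 * ((\<xi> i \<omega>)\<^sup>2 - 2 * t / \<theta> * L i))" for i \<omega>
  define Q where "Q \<omega> = (\<integral>\<^sup>+i. ennreal (q i \<omega>) \<partial>count_space I)" for \<omega>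
  have [measurable]: "(\<lambda>\<omega>. ennreal (q i \<omega>)) \<in> borel_measurable M" if "i \<in> I" for i
    using meas[OF that] unfolding q_def by measurable
  have [measurable]: "Q \<in> borel_measurable M"
    unfolding Q_def using assms(1) by (rule borel_measurable_nn_integral_count_space) measurable
  have q_mean: "(\<integral>\<^sup>+\<omega>. ennreal (q i \<omega>) \<partial>M) = ennreal (exp (- t * L i)) * ennreal (1 / sqrt (1 - \<theta>))"
    if "i \<in> I" for i
  proof -
    have [measurable]: "\<xi> i \<in> borel_measurable M" using that by simp
    have "q i \<omega> = exp (- t * L i) * exp (\<theta> / 2 * (\<xi> i \<omega>)\<^sup>2)" for \<omega>
      using \<theta> unfolding q_def by (simp add: mult_exp_exp right_diff_distrib)
    then have "(\<integral>\<^sup>+\<omega>. ennreal (q i \<omega>) \<partial>M)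
       = (\<integral>\<^sup>+\<omega>. ennreal (exp (- t * L i)) * ennreal (exp (\<theta> / 2 * (\<xi> i \<omega>)\<^sup>2)) \<partial>M)"
      by (simp add: ennreal_mult)
    also have "\<dots> = ennreal (exp (- t * L i)) * (\<integral>\<^sup>+\<omega>. ennreal (exp (\<theta> / 2 * (\<xi> i \<omega>)\<^sup>2)) \<partial>M)"
      by (intro nn_integral_cmult) measurable
    also have "(\<integral>\<^sup>+\<omega>. ennreal (exp (\<theta> / 2 * (\<xi> i \<omega>)\<^sup>2)) \<partial>M) = ennreal (1 / sqrt (1 - \<theta>))"
      using gaussian_rv_exp_square[OF \<open>prob_space M\<close> gauss[OF that] mean[OF that] var[OF that]] \<theta>
      by simp
    finally show ?thesis .
  qed
  have "(\<integral>\<^sup>+\<omega>. Q \<omega> \<partial>M) = (\<integral>\<^sup>+i. \<integral>\<^sup>+\<omega>. ennreal (q i \<omega>) \<partial>M \<partial>count_space I)"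
    unfolding Q_def using assms(1) by (intro nn_integral_count_space_nn_integral) auto
  also have "\<dots> = (\<integral>\<^sup>+i. ennreal (exp (- t * L i)) * ennreal (1 / sqrt (1 - \<theta>)) \<partial>count_space I)"
    by (intro nn_integral_cong) (use q_mean in simp)
  also have "\<dots> = (\<integral>\<^sup>+i. ennreal (exp (- t * L i)) \<partial>count_space I) * ennreal (1 / sqrt (1 - \<theta>))"
    by (intro nn_integral_multc) simp
  also have "\<dots> < \<infinity>"
  proof -
    have "(\<integral>\<^sup>+i. ennreal (norm (exp (- t * L i))) \<partial>count_space I) < \<infinity>"
      using summ unfolding integrable_iff_bounded by simp
    then show ?thesis by (simp add: ennreal_mult_less_top)
  qed
  finally have Q_int: "(\<integral>\<^sup>+\<omega>. Q \<omega> \<partial>M) < \<infinity>" .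
  then have Q_fin: "AE \<omega> in M. Q \<omega> \<noteq> \<infinity>"
    by (intro nn_integral_PInf_AE) auto
  have q_le: "ennreal (q i \<omega>) \<le> Q \<omega>" if "i \<in> I" for i \<omega>
    unfolding Q_def using that by (rule nn_integral_ge_point)
  define R where "R \<omega> = enn2real (Q \<omega>)" for \<omega>
  have R0: "0 \<le> R \<omega>" for \<omega> by (simp add: R_def)
  have [measurable]: "R \<in> borel_measurable M" unfolding R_def by measurable
  have R_int: "integrable M R"
  proof (rule integrableI_nonneg)
    have "(\<integral>\<^sup>+\<omega>. ennreal (R \<omega>) \<partial>M) \<le> (\<integral>\<^sup>+\<omega>. Q \<omega> \<partial>M)"
      unfolding R_def by (intro nn_integral_mono) (metis ennreal_enn2real_if top_greatest zero_le order_refl)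
    also note Q_int
    finally show "(\<integral>\<^sup>+\<omega>. ennreal (R \<omega>) \<partial>M) < \<infinity>" .
  qed (use R0 in auto)
  define G where "G \<omega> = sqrt (2 * t / \<theta> + 2 / (\<theta> * L\<^sub>0) * ln (1 + R \<omega>))" for \<omega>
  have inner0: "0 \<le> 2 * t / \<theta> + 2 / (\<theta> * L\<^sub>0) * ln (1 + R \<omega>)" for \<omega>
    using R0[of \<omega>] \<theta> L0 t by auto
  show ?thesis
  proof (rule that[of G])
    show "G \<in> borel_measurable M" unfolding G_def by measurable
    show "0 \<le> G \<omega>" for \<omega> unfolding G_def using inner0 by simp
    show "AE \<omega> in M. \<forall>i\<in>I. \<bar>\<xi> i \<omega>\<bar> \<le> G \<omega> * sqrt (L i)"
      using Q_fin
    proof eventually_elim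
      case (elim \<omega>)
      show ?case
      proof
        fix i assume i: "i \<in> I"
        have "ennreal (q i \<omega>) \<le> ennreal (R \<omega>)"
          using q_le[OF i, of \<omega>] elim by (simp add: R_def less_top)
        then have "q i \<omega> \<le> 1 + R \<omega>" using R0[of \<omega>] by simp
        then have "ln (q i \<omega>) \<le> ln (1 + R \<omega>)"
          using R0[of \<omega>] by (subst ln_le_cancel_iff) (auto simp: q_def)
        then have "\<theta> / 2 * ((\<xi> i \<omega>)\<^sup>2 - 2 * t / \<theta> * L i) \<le> ln (1 + R \<omega>)"
          by (simp add: q_def)
        then have "2 / \<theta> * (\<theta> / 2 * ((\<xi> i \<omega>)\<^sup>2 - 2 * t / \<theta> * L i)) \<le> 2 / \<theta> * ln (1 + R \<omega>)"
          using \<theta> by (intro mult_left_mono) auto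
        then have "(\<xi> i \<omega>)\<^sup>2 \<le> 2 * t / \<theta> * L i + 2 / \<theta> * ln (1 + R \<omega>)"
          using \<theta> by simp
        also have "2 / \<theta> * ln (1 + R \<omega>) \<le> 2 / (\<theta> * L\<^sub>0) * ln (1 + R \<omega>) * L i"
          using L[OF i] L0 \<theta> R0[of \<omega>] mult_left_mono[of "L\<^sub>0" "L i" "ln (1 + R \<omega>)"]
          by (simp add: field_simps)
        finally have "(\<xi> i \<omega>)\<^sup>2 \<le> (2 * t / \<theta> + 2 / (\<theta> * L\<^sub>0) * ln (1 + R \<omega>)) * L i"
          by (simp add: algebra_simps)
        then have "sqrt ((\<xi> i \<omega>)\<^sup>2) \<le> sqrt ((2 * t / \<theta> + 2 / (\<theta> * L\<^sub>0) * ln (1 + R \<omega>)) * L i)"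
          by (rule real_sqrt_le_mono)
        then show "\<bar>\<xi> i \<omega>\<bar> \<le> G \<omega> * sqrt (L i)" by (simp add: G_def real_sqrt_mult)
      qed
    qed
    show "AE \<omega> in M. finite {i\<in>I. sqrt (2 * t / \<theta>) * sqrt (L i) < \<bar>\<xi> i \<omega>\<bar>}"
      using Q_fin
    proof eventually_elim
      case (elim \<omega>)
      define E where "E = {i\<in>I. 1 \<le> ennreal (q i \<omega>)}"
      have "emeasure (count_space I) E \<le> (\<integral>\<^sup>+i. ennreal (q i \<omega>) \<partial>count_space I)"
      proof -
        have "emeasure (count_space I) E = (\<integral>\<^sup>+i. indicator E i \<partial>count_space I)"
          by (subst nn_integral_indicator) (auto simp: E_def)
        also have "\<dots> \<le> (\<integral>\<^sup>+i. ennreal (q i \<omega>) \<partial>count_space I)"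
          by (intro nn_integral_mono) (auto simp: E_def split: split_indicator)
        finally show ?thesis .
      qed
      then have "emeasure (count_space I) E \<noteq> \<infinity>"
        using elim unfolding Q_def by (auto simp: top_unique)
      then have "finite E"
        by (metis (no_types, lifting) E_def emeasure_count_space_infinite infinity_ennreal_def mem_Collect_eq subsetI)
      moreover have "{i\<in>I. sqrt (2 * t / \<theta>) * sqrt (L i) < \<bar>\<xi> i \<omega>\<bar>} \<subseteq> E"
      proof
        fix i assume i: "i \<in> {i\<in>I. sqrt (2 * t / \<theta>) * sqrt (L i) < \<bar>\<xi> i \<omega>\<bar>}"
        then have "sqrt (2 * t / \<theta> * L i) \<le> \<bar>\<xi> i \<omega>\<bar>"
          unfolding real_sqrt_mult by simp
        then have "2 * t / \<theta> * L i \<le> (\<xi> i \<omega>)\<^sup>2"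
          using sqrt_le_D by fastforce
        then have "1 \<le> q i \<omega>" unfolding q_def using \<theta> by (subst one_le_exp_iff) simp
        then show "i \<in> E" using i by (simp add: E_def ennreal_ge_1)
      qed
      ultimately show ?case by (rule finite_subset[rotated])
    qed
    fix \<alpha> :: real assume \<alpha>: "0 \<le> \<alpha>" "2 * \<alpha> \<le> \<theta> * L\<^sub>0"
    show "integrable M (\<lambda>\<omega>. exp (\<alpha> * (G \<omega>)\<^sup>2))"
    proof (rule Bochner_Integration.integrable_bound)
      show "integrable M (\<lambda>\<omega>. exp (\<alpha> * (2 * t / \<theta>)) * (1 + R \<omega>))"
        using R_int by simp
      show "(\<lambda>\<omega>. exp (\<alpha> * (G \<omega>)\<^sup>2)) \<in> borel_measurable M" unfolding G_def by measurable
      show "AE \<omega> in M. norm (exp (\<alpha> * (G \<omega>)\<^sup>2)) \<le> norm (exp (\<alpha> * (2 * t / \<theta>)) * (1 + R \<omega>))"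
      proof (rule AE_I2)
        fix \<omega>
        have "\<alpha> * (2 / (\<theta> * L\<^sub>0)) \<le> 1" using \<alpha> \<theta> L0 by (simp add: field_simps)
        then have "\<alpha> * (2 / (\<theta> * L\<^sub>0)) * ln (1 + R \<omega>) \<le> 1 * ln (1 + R \<omega>)"
          using R0[of \<omega>] by (intro mult_right_mono) auto
        then have "\<alpha> * (G \<omega>)\<^sup>2 \<le> \<alpha> * (2 * t / \<theta>) + ln (1 + R \<omega>)"
          unfolding G_def using inner0[of \<omega>] by (simp add: distrib_left)
        then have "exp (\<alpha> * (G \<omega>)\<^sup>2) \<le> exp (\<alpha> * (2 * t / \<theta>) + ln (1 + R \<omega>))" by simp
        also have "\<dots> = exp (\<alpha> * (2 * t / \<theta>)) * (1 + R \<omega>)"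
          using R0[of \<omega>] by (simp add: exp_add add_nonneg_pos)
        finally show "norm (exp (\<alpha> * (G \<omega>)\<^sup>2)) \<le> norm (exp (\<alpha> * (2 * t / \<theta>)) * (1 + R \<omega>))"
          using R0[of \<omega>] by simp
      qed
    qed
  qed
qed

section \<open>Rectangular increments and their variance\<close>

text \<open>The increment in the coordinates of \<open>S\<close> only; inductions on \<open>S\<close> build up the full increment.\<close>

definition partial_increment ::
  "'n set \<Rightarrow> real ^ 'n \<Rightarrow> (real ^ 'n \<Rightarrow> real) \<Rightarrow> real ^ 'n \<Rightarrow> real" where
  "partial_increment S y f = Finite_Set.fold (coord_increment y) f S"

lemma partial_increment_empty [simp]: "partial_increment {} y f = f"
  by (simp add: partial_increment_def)

lemma partial_increment_insert:
  fixes y :: "real ^ 'n"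
  assumes "k \<notin> S"
  shows "partial_increment (insert k S) y f x
       = partial_increment S y f x - partial_increment S y f (replace_coord k y x)"
proof -
  interpret comp_fun_commute "coord_increment y" by (rule comp_fun_commute_coord_increment)
  have "finite S" by simp
  then show ?thesis
    using assms by (simp add: partial_increment_def coord_increment_def)
qed

lemma rect_increment_partial: "rect_increment = partial_increment UNIV"
  by (simp add: fun_eq_iff rect_increment_def partial_increment_def)

definition upd :: "real ^ 'n \<Rightarrow> 'n \<Rightarrow> real \<Rightarrow> real ^ 'n" where
  "upd x k t = (\<chi> i. if i = k then t else x $ i)"

lemma upd_nth [simp]: "upd x k t $ i = (if i = k then t else x $ i)"
  by (simp add: upd_def)

lemma replace_coord_nth [simp]: "replace_coord k y x $ i = (if i = k then y $ k else x $ i)"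
  by (simp add: replace_coord_def)

lemma upd_triv [simp]: "upd x k (x $ k) = x"
  by (simp add: vec_eq_iff)

lemma partial_increment_cong:
  fixes y :: "real ^ 'n"
  assumes "\<And>k. k \<in> S \<Longrightarrow> y $ k = y' $ k"
  shows "partial_increment S y f = partial_increment S y' f"
proof -
  have "finite S" by simp
  then show ?thesis using assms
  proof (induction S)
    case (insert k S)
    then have "replace_coord k y x = replace_coord k y' x" for x
      by (simp add: vec_eq_iff)
    with insert show ?case by (simp add: fun_eq_iff partial_increment_insert)
  qed simp
qed

lemma continuous_on_partial_increment:
  fixes y :: "real ^ 'n"
  assumes "continuous_on UNIV f"
  shows "continuous_on UNIV (partial_increment S y f)"
proof -
  have "finite S" by simp
  then show ?thesis
  proof (induction S)
    case (insert k S)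
    have "continuous_on UNIV (replace_coord k y)"
      unfolding replace_coord_def
    proof (rule continuous_on_vec_lambda)
      show "continuous_on UNIV (\<lambda>x. if i = k then y $ k else x $ i)" for i
        by (cases "i = k") (auto intro: continuous_intros)
    qed
    then have "continuous_on UNIV (\<lambda>x. partial_increment S y f (replace_coord k y x))"
      by (rule continuous_on_compose2[OF insert.IH]) auto
    moreover have "partial_increment (insert k S) y f
        = (\<lambda>x. partial_increment S y f x - partial_increment S y f (replace_coord k y x))"
      using insert.hyps by (simp add: fun_eq_iff partial_increment_insert)
    ultimately show ?case using insert.IH by (simp add: continuous_on_diff)
  qed (use assms in simp)
qed

text \<open>Performing the increment in coordinate \<open>k\<close> last exhibits it as a difference of one function at the
  two end points. This additivity in each coordinate reduces statements about boxes to statements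
  about intervals.\<close>

lemma rect_increment_coord:
  fixes x y :: "real ^ 'n"
  assumes "continuous_on UNIV f"
  obtains g :: "real \<Rightarrow> real" where "continuous_on UNIV g"
    and "\<And>a b. rect_increment (upd y k b) f (upd x k a) = g a - g b"
proof
  define g where "g a = partial_increment (UNIV - {k}) y f (upd x k a)" for a
  have "continuous_on UNIV (upd x k)"
    unfolding upd_def
  proof (rule continuous_on_vec_lambda)
    show "continuous_on UNIV (\<lambda>t. if i = k then t else x $ i)" for i
      by (cases "i = k") auto
  qed
  then show "continuous_on UNIV g"
    unfolding g_def
    by (rule continuous_on_compose2[OF continuous_on_partial_increment[OF assms]]) auto
  fix a b
  have UN: "UNIV = insert k (UNIV - {k})" by auto
  have "rect_increment (upd y k b) f (upd x k a)
    = partial_increment (UNIV - {k}) (upd y k b) f (upd x k a)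
      - partial_increment (UNIV - {k}) (upd y k b) f (replace_coord k (upd y k b) (upd x k a))"
    unfolding rect_increment_partial by (subst UN, subst partial_increment_insert) auto
  also have "partial_increment (UNIV - {k}) (upd y k b) f = partial_increment (UNIV - {k}) y f"
    by (rule partial_increment_cong) simp
  also have "replace_coord k (upd y k b) (upd x k a) = upd x k b"
    by (simp add: vec_eq_iff)
  finally show "rect_increment (upd y k b) f (upd x k a) = g a - g b"
    by (simp add: g_def)
qed

lemma rect_increment_eq_0:
  fixes x y :: "real ^ 'n"
  assumes "continuous_on UNIV f" "x $ k = y $ k"
  shows "rect_increment y f x = 0"
proof -
  obtain g where "\<And>a b. rect_increment (upd y k b) f (upd x k a) = g a - g b"
    using rect_increment_coord[OF assms(1), where k = k and x = x and y = y] by metis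
  moreover have "upd y k (x $ k) = y" using assms(2) by (simp add: vec_eq_iff)
  ultimately show ?thesis by (metis diff_self upd_triv)
qed

text \<open>Makes increments of a Gaussian field Gaussian.\<close>

lemma partial_increment_linear_combination:
  fixes W :: "real ^ 'n \<Rightarrow> 'a \<Rightarrow> real"
  shows "\<exists>I a. finite I \<and>
    (\<forall>\<omega>. partial_increment S y (\<lambda>z. W z \<omega>) x = (\<Sum>i\<in>I. a i * W i \<omega>))"
proof -
  have "finite S" by simp
  then show ?thesis
  proof (induction S arbitrary: x)
    case empty
    show ?case by (intro exI[of _ "{x}"] exI[of _ "\<lambda>_. 1"]) simp
  next
    case (insert k S)
    obtain I a where I: "finite I"
      "\<And>\<omega>. partial_increment S y (\<lambda>z. W z \<omega>) x = (\<Sum>i\<in>I. a i * W i \<omega>)"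
      using insert.IH by blast
    obtain J b where J: "finite J"
      "\<And>\<omega>. partial_increment S y (\<lambda>z. W z \<omega>) (replace_coord k y x) = (\<Sum>i\<in>J. b i * W i \<omega>)"
      using insert.IH by blast
    \<comment> \<open>The two sets of points may overlap.\<close>
    define c where "c i = (if i \<in> I then a i else 0) - (if i \<in> J then b i else 0)" for i
    have "(\<Sum>i\<in>I \<union> J. c i * W i \<omega>) = (\<Sum>i\<in>I. a i * W i \<omega>) - (\<Sum>i\<in>J. b i * W i \<omega>)" for \<omega>
    proof -
      have "(\<Sum>i\<in>I \<union> J. c i * W i \<omega>)
          = (\<Sum>i\<in>I \<union> J. if i \<in> I then a i * W i \<omega> else 0)
            - (\<Sum>i\<in>I \<union> J. if i \<in> J then b i * W i \<omega> else 0)"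
        unfolding sum_subtractf[symmetric]
        by (intro sum.cong) (auto simp: c_def algebra_simps)
      also have "(\<Sum>i\<in>I \<union> J. if i \<in> I then a i * W i \<omega> else 0) = (\<Sum>i\<in>I. a i * W i \<omega>)"
        using I(1) J(1) by (intro sum.mono_neutral_cong_right) auto
      also have "(\<Sum>i\<in>I \<union> J. if i \<in> J then b i * W i \<omega> else 0) = (\<Sum>i\<in>J. b i * W i \<omega>)"
        using I(1) J(1) by (intro sum.mono_neutral_cong_right) auto
      finally show ?thesis .
    qed
    then show ?case
      using I J insert.hyps
      by (intro exI[of _ "I \<union> J"] exI[of _ c]) (simp add: partial_increment_insert)
  qed
qed

text \<open>The mixed second difference of the one-dimensional covariance: the covariance of
  \<open>B\<^sub>s - B\<^sub>u\<close> and \<open>B\<^sub>t - B\<^sub>u\<close> for a fractional Brownian motion \<open>B\<close>.\<close>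

definition cov_increment :: "real \<Rightarrow> real \<Rightarrow> real \<Rightarrow> real \<Rightarrow> real" where
  "cov_increment h s t u = fbm_cov h s t - fbm_cov h s u - fbm_cov h u t + fbm_cov h u u"

lemma cov_increment_same: "0 < h \<Longrightarrow> cov_increment h s s u = \<bar>s - u\<bar> powr (2 * h)"
  by (simp add: cov_increment_def fbm_cov_def abs_minus_commute field_simps)

context
  fixes M :: "'a measure" and H :: "real ^ 'n" and W :: "real ^ 'n \<Rightarrow> 'a \<Rightarrow> real"
  assumes fbf: "continuous_fbf M H W"
begin

lemma prob_M: "prob_space M" using fbf by (simp add: continuous_fbf_def)

interpretation prob_space M by (rule prob_M)

lemma gaussian_partial_increment:
  "gaussian_rv M (\<lambda>\<omega>. partial_increment S y (\<lambda>z. W z \<omega>) x / s)"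
proof -
  obtain I a where I: "finite I"
    "\<And>\<omega>. partial_increment S y (\<lambda>z. W z \<omega>) x = (\<Sum>i\<in>I. a i * W i \<omega>)"
    using partial_increment_linear_combination[of S y W x] by blast
  have "gaussian_field M W" using fbf by (simp add: continuous_fbf_def)
  from this[unfolded gaussian_field_def, rule_format, OF I(1), of "\<lambda>i. a i / s"]
  have "gaussian_rv M (\<lambda>\<omega>. \<Sum>i\<in>I. (a i / s) * W i \<omega>)" .
  then show ?thesis by (simp add: I(2) sum_divide_distrib)
qed

lemma integrable_partial_increment:
  "integrable M (\<lambda>\<omega>. partial_increment S y (\<lambda>z. W z \<omega>) x)"
  using gaussian_rv_integrable(1)[OF prob_M gaussian_partial_increment[of S y x 1]] by simp

lemma integrable_partial_increment_mult:
  "integrable M (\<lambda>\<omega>. partial_increment S y (\<lambda>z. W z \<omega>) x * partial_increment S y (\<lambda>z. W z \<omega>) x')"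
proof (rule Bochner_Integration.integrable_bound)
  let ?A = "\<lambda>x \<omega>. partial_increment S y (\<lambda>z. W z \<omega>) x"
  show "integrable M (\<lambda>\<omega>. (?A x \<omega>)\<^sup>2 + (?A x' \<omega>)\<^sup>2)"
    using gaussian_rv_integrable(2)[OF prob_M gaussian_partial_increment[of S y x 1]]
      gaussian_rv_integrable(2)[OF prob_M gaussian_partial_increment[of S y x' 1]] by simp
  show "(\<lambda>\<omega>. ?A x \<omega> * ?A x' \<omega>) \<in> borel_measurable M"
    using integrable_partial_increment[THEN borel_measurable_integrable] by measurable
  have "\<bar>a * b\<bar> \<le> a\<^sup>2 + b\<^sup>2" for a b :: real
  proof -
    have "0 \<le> \<bar>a\<bar> * \<bar>b\<bar>" by simp
    then show ?thesis
      using sum_squares_bound[of "\<bar>a\<bar>" "\<bar>b\<bar>"] unfolding abs_mult power2_abs by linarith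
  qed
  then show "AE \<omega> in M. norm (?A x \<omega> * ?A x' \<omega>) \<le> norm ((?A x \<omega>)\<^sup>2 + (?A x' \<omega>)\<^sup>2)"
    by simp
qed

lemma expectation_partial_increment:
  "expectation (\<lambda>\<omega>. partial_increment S y (\<lambda>z. W z \<omega>) x) = 0"
proof -
  have "finite S" by simp
  then show ?thesis
  proof (induction S arbitrary: x)
    case empty
    then show ?case using fbf by (simp add: continuous_fbf_def)
  next
    case (insert k S)
    then show ?case by (simp add: partial_increment_insert integrable_partial_increment)
  qed
qed

text \<open>Each operator \<open>I - V\<^sub>k\<^sub>,\<^sub>y\<close> acts on the \<open>k\<close>-th factor of the covariance alone, so the factors
  with index in \<open>S\<close> are replaced by second differences and the others stay. Keeping the two base
  points different is needed for the induction, since the operators move them independently.\<close>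

lemma covariance_partial_increment:
  "expectation (\<lambda>\<omega>. partial_increment S y (\<lambda>z. W z \<omega>) x * partial_increment S y (\<lambda>z. W z \<omega>) x')
     = (\<Prod>k\<in>S. cov_increment (H $ k) (x $ k) (x' $ k) (y $ k))
       * (\<Prod>k\<in>UNIV - S. fbm_cov (H $ k) (x $ k) (x' $ k))"
proof -
  have "finite S" by simp
  then show ?thesis
  proof (induction S arbitrary: x x')
    case empty
    then show ?case using fbf by (simp add: continuous_fbf_def)
  next
    case (insert k S)
    let ?A = "\<lambda>x \<omega>. partial_increment S y (\<lambda>z. W z \<omega>) x"
    let ?r = "replace_coord k y"
    define P where "P = (\<Prod>j\<in>S. cov_increment (H $ j) (x $ j) (x' $ j) (y $ j))"
    define Q where "Q = (\<Prod>j\<in>UNIV - insert k S. fbm_cov (H $ j) (x $ j) (x' $ j))"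
    have UN: "UNIV - S = insert k (UNIV - insert k S)" using insert.hyps by auto
    have IH: "expectation (\<lambda>\<omega>. ?A u \<omega> * ?A v \<omega>) = P * (fbm_cov (H $ k) (u $ k) (v $ k) * Q)"
      if "u = x \<or> u = ?r x" "v = x' \<or> v = ?r x'" for u v
    proof -
      have eq: "u $ j = x $ j" "v $ j = x' $ j" if "j \<noteq> k" for j
        using that \<open>u = x \<or> u = ?r x\<close> \<open>v = x' \<or> v = ?r x'\<close> by auto
      have "j \<noteq> k" if "j \<in> S" for j using that insert.hyps by auto
      then have "(\<Prod>j\<in>S. cov_increment (H $ j) (u $ j) (v $ j) (y $ j)) = P"
        unfolding P_def by (intro prod.cong) (simp_all add: eq)
      moreover have "(\<Prod>j\<in>UNIV - S. fbm_cov (H $ j) (u $ j) (v $ j))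
        = fbm_cov (H $ k) (u $ k) (v $ k) * Q"
        unfolding UN Q_def by (subst prod.insert) (auto simp: eq intro!: prod.cong)
      ultimately show ?thesis by (simp add: insert.IH)
    qed
    have "expectation (\<lambda>\<omega>. partial_increment (insert k S) y (\<lambda>z. W z \<omega>) x
            * partial_increment (insert k S) y (\<lambda>z. W z \<omega>) x')
      = expectation (\<lambda>\<omega>. ?A x \<omega> * ?A x' \<omega> - ?A x \<omega> * ?A (?r x') \<omega>
            - ?A (?r x) \<omega> * ?A x' \<omega> + ?A (?r x) \<omega> * ?A (?r x') \<omega>)"
      using insert.hyps by (simp add: partial_increment_insert algebra_simps)
    also have "\<dots> = expectation (\<lambda>\<omega>. ?A x \<omega> * ?A x' \<omega>) - expectation (\<lambda>\<omega>. ?A x \<omega> * ?A (?r x') \<omega>)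
            - expectation (\<lambda>\<omega>. ?A (?r x) \<omega> * ?A x' \<omega>) + expectation (\<lambda>\<omega>. ?A (?r x) \<omega> * ?A (?r x') \<omega>)"
      by (simp add: integrable_partial_increment_mult)
    also have "\<dots> = cov_increment (H $ k) (x $ k) (x' $ k) (y $ k) * P * Q"
      by (simp add: IH) (simp add: cov_increment_def algebra_simps)
    finally show ?case using insert.hyps by (simp add: P_def Q_def)
  qed
qed

lemma variance_rect_increment:
  assumes "\<And>k. 0 < H $ k"
  shows "expectation (\<lambda>\<omega>. (rect_increment y (\<lambda>z. W z \<omega>) x)\<^sup>2)
       = (\<Prod>k\<in>UNIV. \<bar>x $ k - y $ k\<bar> powr (H $ k))\<^sup>2"
proof -
  have "expectation (\<lambda>\<omega>. (rect_increment y (\<lambda>z. W z \<omega>) x)\<^sup>2)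
      = (\<Prod>k\<in>UNIV. \<bar>x $ k - y $ k\<bar> powr (2 * H $ k))"
    using covariance_partial_increment[of UNIV y x x] assms
    by (simp add: rect_increment_partial power2_eq_square cov_increment_same)
  also have "\<dots> = (\<Prod>k\<in>UNIV. (\<bar>x $ k - y $ k\<bar> powr (H $ k))\<^sup>2)"
    by (intro prod.cong) (simp_all add: power2_eq_square flip: powr_add)
  finally show ?thesis by (simp add: prod_power_distrib)
qed

lemma normalized_rect_increment:
  fixes x y :: "real ^ 'n"
  assumes "\<And>k. 0 < H $ k" and ne: "\<And>k. x $ k \<noteq> y $ k"
  defines "\<xi> \<equiv> \<lambda>\<omega>. rect_increment y (\<lambda>z. W z \<omega>) x / (\<Prod>k\<in>UNIV. \<bar>x $ k - y $ k\<bar> powr (H $ k))"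
  shows "gaussian_rv M \<xi>" "expectation \<xi> = 0" "expectation (\<lambda>\<omega>. (\<xi> \<omega>)\<^sup>2) = 1"
proof -
  show "gaussian_rv M \<xi>"
    unfolding \<xi>_def rect_increment_partial by (rule gaussian_partial_increment)
  show "expectation \<xi> = 0"
    unfolding \<xi>_def rect_increment_partial by (simp add: expectation_partial_increment)
  show "expectation (\<lambda>\<omega>. (\<xi> \<omega>)\<^sup>2) = 1"
    unfolding \<xi>_def power_divide using ne by (simp add: variance_rect_increment[OF assms(1)])
qed

end

section \<open>Chaining and rounding of boxes\<close>

text \<open>Chaining on an interval: approximate \<open>x\<close> and \<open>y\<close> from below by their dyadic truncations. Passing
  from level \<open>l\<close> to \<open>l + 1\<close> moves a truncation by at most one dyadic step, and at level \<open>m\<close> the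
  truncations of \<open>x\<close> and \<open>y\<close> differ by at most one step. The constant depends on \<open>q\<close> only and not on
  \<open>B\<close>, because \<open>sqrt (1 + B + m + j) \<le> sqrt (1 + B + m) * (1 + j)\<close>; this lets \<open>B\<close> absorb the levels
  of the other coordinates when boxes are treated one coordinate at a time.\<close>

lemma dyadic_chaining:
  fixes q :: real
  assumes q: "0 < q" "q < 1"
  shows "\<exists>C\<ge>0. \<forall>g A B m x y. continuous_on UNIV g \<longrightarrow> 0 \<le> A \<longrightarrow> 0 \<le> B \<longrightarrow>
      (\<forall>l i::nat. i < 2 ^ l \<longrightarrow>
         \<bar>g (real i / 2 ^ l) - g ((real i + 1) / 2 ^ l)\<bar> \<le> A * q ^ l * sqrt (1 + B + real l)) \<longrightarrow>
      x \<in> {0..1} \<longrightarrow> y \<in> {0..1} \<longrightarrow> \<bar>x - y\<bar> \<le> 1 / 2 ^ m \<longrightarrow>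
      \<bar>g x - g y\<bar> \<le> C * (A * q ^ m * sqrt (1 + B + real m))"
proof -
  define D where "D = 1 / (1 - q)\<^sup>2"
  have D: "(\<lambda>j. real (Suc j) * q ^ j) sums D"
    unfolding D_def using q by (intro geometric_deriv_sums) simp
  have D0: "0 \<le> D" by (simp add: D_def)
  have "\<bar>g x - g y\<bar> \<le> (1 + 2 * D) * (A * q ^ m * sqrt (1 + B + real m))"
    if g: "continuous_on UNIV g" and A: "0 \<le> A" and B: "0 \<le> B"
    and step: "\<And>l i::nat. i < 2 ^ l \<Longrightarrow>
         \<bar>g (real i / 2 ^ l) - g ((real i + 1) / 2 ^ l)\<bar> \<le> A * q ^ l * sqrt (1 + B + real l)"
    and x: "x \<in> {0..1}" and y: "y \<in> {0..1}" and xy: "\<bar>x - y\<bar> \<le> 1 / 2 ^ m"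
    for g :: "real \<Rightarrow> real" and A B m x y
  proof -
    define a where "a z l = real_of_int \<lfloor>2 ^ l * z\<rfloor> / 2 ^ l" for z :: real and l :: nat
    define T where "T = A * q ^ m * sqrt (1 + B + real m)"
    have T0: "0 \<le> T" using A B q by (simp add: T_def)
    have step': "\<bar>g (a z l) - g (a z' l)\<bar> \<le> A * q ^ l * sqrt (1 + B + real l)"
      if "z \<in> {0..1}" "\<lfloor>2 ^ l * z\<rfloor> = \<lfloor>2 ^ l * z'\<rfloor> + 1" "0 \<le> z'" for z z' l
    proof -
      define i where "i = nat \<lfloor>2 ^ l * z'\<rfloor>"
      have i: "\<lfloor>2 ^ l * z'\<rfloor> = int i" using that by (simp add: i_def)
      have "real_of_int \<lfloor>2 ^ l * z\<rfloor> \<le> 2 ^ l * z" by simp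
      also have "\<dots> \<le> 2 ^ l" using that(1) by simp
      finally have "real i + 1 \<le> 2 ^ l" using that(2) i by simp
      then have "real (Suc i) \<le> real (2 ^ l)" by simp
      then have "i < 2 ^ l" unfolding of_nat_le_iff by simp
      from step[OF this] show ?thesis using that(2) i by (simp add: a_def abs_minus_commute add.commute)
    qed
    have refine: "\<bar>g (a z (Suc l)) - g (a z l)\<bar> \<le> A * q ^ Suc l * sqrt (1 + B + real (Suc l))"
      if z: "z \<in> {0..1}" for z l
    proof -
      define n where "n = \<lfloor>2 ^ l * z\<rfloor>"
      have "\<lfloor>2 ^ Suc l * z\<rfloor> = 2 * n \<or> \<lfloor>2 ^ Suc l * z\<rfloor> = 2 * n + 1"
        unfolding n_def by simp linarith
      then show ?thesis
      proof
        assume "\<lfloor>2 ^ Suc l * z\<rfloor> = 2 * n"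
        then have "a z (Suc l) = a z l" by (simp add: a_def n_def)
        then show ?thesis using A B q by simp
      next
        assume *: "\<lfloor>2 ^ Suc l * z\<rfloor> = 2 * n + 1"
        have z': "\<lfloor>2 ^ Suc l * a z l\<rfloor> = 2 * n"
        proof -
          have "2 ^ Suc l * a z l = real_of_int (2 * n)" by (simp add: a_def n_def)
          then show ?thesis by (metis floor_of_int)
        qed
        have "a (a z l) (Suc l) = a z l"
          unfolding a_def[of "a z l"] z' by (simp add: a_def n_def)
        moreover have "0 \<le> a z l" using z by (simp add: a_def)
        ultimately show ?thesis using step'[of z "Suc l" "a z l"] z * z' by simp
      qed
    qed
    have approx: "\<bar>g z - g (a z m)\<bar> \<le> T * D" if z: "z \<in> {0..1}" for z
    proof -
      have part: "\<bar>g (a z (m + N)) - g (a z m)\<bar> \<le> T * (\<Sum>j<N. real (Suc (Suc j)) * q ^ Suc j)" for N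
      proof (induction N)
        case (Suc N)
        have "\<bar>g (a z (Suc (m + N))) - g (a z (m + N))\<bar>
            \<le> A * q ^ Suc (m + N) * sqrt (1 + B + real (Suc (m + N)))"
          by (rule refine[OF z])
        also have "\<dots> \<le> A * q ^ Suc (m + N) * (sqrt (1 + B + real m) * real (Suc (Suc N)))"
        proof (intro mult_left_mono)
          have "1 + B + real (Suc (m + N)) \<le> (1 + B + real m) * real (Suc (Suc N))"
            using B by (simp add: algebra_simps)
          also have "\<dots> \<le> (1 + B + real m) * (real (Suc (Suc N)))\<^sup>2"
            using B by (intro mult_left_mono) (auto simp: power2_eq_square)
          finally have "sqrt (1 + B + real (Suc (m + N)))
              \<le> sqrt ((1 + B + real m) * (real (Suc (Suc N)))\<^sup>2)"
            by (rule real_sqrt_le_mono)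
          then show "sqrt (1 + B + real (Suc (m + N))) \<le> sqrt (1 + B + real m) * real (Suc (Suc N))"
            unfolding real_sqrt_mult by simp
        qed (use A q in auto)
        also have "\<dots> = T * (real (Suc (Suc N)) * q ^ Suc N)"
          by (simp add: T_def power_add)
        finally show ?case using Suc.IH by (simp add: algebra_simps)
      qed simp
      have "\<bar>g (a z (m + N)) - g (a z m)\<bar> \<le> T * D" for N
      proof -
        have "(\<Sum>j<N. real (Suc (Suc j)) * q ^ Suc j) \<le> (\<Sum>j<Suc N. real (Suc j) * q ^ j)"
          unfolding sum.lessThan_Suc_shift by simp
        also have "\<dots> \<le> D"
          using D q by (intro sum_le_suminf[of _ "{..<Suc N}", THEN order_trans])
            (auto simp: sums_iff)
        finally have "T * (\<Sum>j<N. real (Suc (Suc j)) * q ^ Suc j) \<le> T * D"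
          using T0 by (rule mult_left_mono)
        with part[of N] show ?thesis by linarith
      qed
      moreover have "(\<lambda>N. \<bar>g (a z (m + N)) - g (a z m)\<bar>) \<longlonglongrightarrow> \<bar>g z - g (a z m)\<bar>"
      proof -
        have "(\<lambda>l. a z l) \<longlonglongrightarrow> z"
        proof (rule tendsto_sandwich)
          show "(\<lambda>l. z - (1 / 2) ^ l) \<longlonglongrightarrow> z"
            by (rule tendsto_eq_intros LIMSEQ_realpow_zero refl | simp)+
          show "(\<lambda>l. z) \<longlonglongrightarrow> z" by simp
          have "z - (1 / 2) ^ l = (2 ^ l * z - 1) / 2 ^ l" for l
            by (simp add: field_simps power_divide)
          moreover have "(2 ^ l * z - 1) / 2 ^ l \<le> a z l" for l
            unfolding a_def by (intro divide_right_mono) (linarith, simp)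
          moreover have "a z l \<le> (2 ^ l * z) / 2 ^ l" for l
            unfolding a_def by (intro divide_right_mono) (linarith, simp)
          ultimately have "z - (1 / 2) ^ l \<le> a z l" "a z l \<le> z" for l
            by simp_all
          then show "\<forall>\<^sub>F l in sequentially. z - (1 / 2) ^ l \<le> a z l"
            "\<forall>\<^sub>F l in sequentially. a z l \<le> z" by auto
        qed
        then have "(\<lambda>N. a z (N + m)) \<longlonglongrightarrow> z" by (rule LIMSEQ_ignore_initial_segment)
        then have "(\<lambda>N. a z (m + N)) \<longlonglongrightarrow> z" by (simp add: add.commute)
        moreover have "isCont g z" using g by (simp add: continuous_on_eq_continuous_at)
        ultimately have "(\<lambda>N. g (a z (m + N))) \<longlonglongrightarrow> g z" by (rule isCont_tendsto_compose[rotated])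
        then show ?thesis by (intro tendsto_intros)
      qed
      ultimately show ?thesis by (intro LIMSEQ_le_const2) auto
    qed
    have close: "\<bar>g (a x m) - g (a y m)\<bar> \<le> T"
    proof -
      have "\<bar>2 ^ m * x - 2 ^ m * y\<bar> = 2 ^ m * \<bar>x - y\<bar>"
        by (simp add: abs_mult flip: right_diff_distrib)
      also have "\<dots> \<le> 2 ^ m * (1 / 2 ^ m)" using xy by (intro mult_left_mono) auto
      finally have "\<bar>2 ^ m * x - 2 ^ m * y\<bar> \<le> 1" by simp
      then have "\<lfloor>2 ^ m * x\<rfloor> = \<lfloor>2 ^ m * y\<rfloor> \<or> \<lfloor>2 ^ m * x\<rfloor> = \<lfloor>2 ^ m * y\<rfloor> + 1
          \<or> \<lfloor>2 ^ m * y\<rfloor> = \<lfloor>2 ^ m * x\<rfloor> + 1"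
        by linarith
      then consider "a x m = a y m" | "\<lfloor>2 ^ m * x\<rfloor> = \<lfloor>2 ^ m * y\<rfloor> + 1" | "\<lfloor>2 ^ m * y\<rfloor> = \<lfloor>2 ^ m * x\<rfloor> + 1"
        by (auto simp: a_def)
      then show ?thesis
      proof cases
        case 1 then show ?thesis using T0 by simp
      next
        case 2 then show ?thesis using step'[of x m y] x y by (simp add: T_def)
      next
        case 3 then show ?thesis using step'[of y m x] x y by (simp add: T_def abs_minus_commute)
      qed
    qed
    have "\<bar>g x - g y\<bar> \<le> T + 2 * (T * D)"
      using approx[OF x] approx[OF y] close by linarith
    then show ?thesis by (simp add: T_def algebra_simps)
  qed
  then show ?thesis using D0 by (intro exI[of _ "1 + 2 * D"]) auto
qed

text \<open>Induction on the set of coordinates in which the box is arbitrary rather than dyadic: by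
  \<open>rect_increment_coord\<close>, freeing one more coordinate is an instance of chaining on an interval.\<close>

lemma rect_increment_chaining:
  fixes q :: "'n::finite \<Rightarrow> real"
  assumes q: "\<And>k. 0 < q k" "\<And>k. q k < 1"
  shows "\<exists>C\<ge>0. \<forall>(f :: real ^ 'n \<Rightarrow> real) \<Gamma> l x y. continuous_on UNIV f \<longrightarrow> 0 \<le> \<Gamma> \<longrightarrow>
      (\<forall>l i. (\<forall>k. i k < 2 ^ l k) \<longrightarrow>
         \<bar>rect_increment (\<chi> k. (real (i k) + 1) / 2 ^ l k) f (\<chi> k. real (i k) / 2 ^ l k)\<bar>
           \<le> \<Gamma> * (\<Prod>k\<in>UNIV. q k ^ l k) * sqrt (1 + real (\<Sum>k\<in>UNIV. l k))) \<longrightarrow>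
      (\<forall>k. x $ k \<in> {0..1} \<and> y $ k \<in> {0..1} \<and> \<bar>x $ k - y $ k\<bar> \<le> 1 / 2 ^ l k) \<longrightarrow>
      \<bar>rect_increment y f x\<bar> \<le> C * \<Gamma> * (\<Prod>k\<in>UNIV. q k ^ l k) * sqrt (1 + real (\<Sum>k\<in>UNIV. l k))"
proof -
  have "\<forall>k. \<exists>C\<ge>0. \<forall>g A B m x y. continuous_on UNIV g \<longrightarrow> 0 \<le> A \<longrightarrow> 0 \<le> B \<longrightarrow>
      (\<forall>l i::nat. i < 2 ^ l \<longrightarrow>
         \<bar>g (real i / 2 ^ l) - g ((real i + 1) / 2 ^ l)\<bar> \<le> A * q k ^ l * sqrt (1 + B + real l)) \<longrightarrow>
      x \<in> {0..1} \<longrightarrow> y \<in> {0..1} \<longrightarrow> \<bar>x - y\<bar> \<le> 1 / 2 ^ m \<longrightarrow>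
      \<bar>g x - g y\<bar> \<le> C * (A * q k ^ m * sqrt (1 + B + real m))"
    using dyadic_chaining q by blast
  then obtain C where C0: "\<And>k. 0 \<le> C k"
    and C: "\<And>k g A B m x y. continuous_on UNIV g \<Longrightarrow> 0 \<le> A \<Longrightarrow> 0 \<le> B \<Longrightarrow>
      (\<And>l i::nat. i < 2 ^ l \<Longrightarrow>
         \<bar>g (real i / 2 ^ l) - g ((real i + 1) / 2 ^ l)\<bar> \<le> A * q k ^ l * sqrt (1 + B + real l)) \<Longrightarrow>
      x \<in> {0..1} \<Longrightarrow> y \<in> {0..1} \<Longrightarrow> \<bar>x - y\<bar> \<le> 1 / 2 ^ m \<Longrightarrow>
      \<bar>g x - g y\<bar> \<le> C k * (A * q k ^ m * sqrt (1 + B + real m))"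
    by metis
  have main: "\<bar>rect_increment y f x\<bar>
      \<le> (\<Prod>k\<in>S. C k) * \<Gamma> * (\<Prod>k\<in>UNIV. q k ^ l k) * sqrt (1 + real (\<Sum>k\<in>UNIV. l k))"
    if f: "continuous_on UNIV f" and \<Gamma>: "0 \<le> \<Gamma>"
      and dyadic: "\<And>l i. (\<And>k. i k < 2 ^ l k) \<Longrightarrow>
         \<bar>rect_increment (\<chi> k. (real (i k) + 1) / 2 ^ l k) f (\<chi> k. real (i k) / 2 ^ l k)\<bar>
           \<le> \<Gamma> * (\<Prod>k\<in>UNIV. q k ^ l k) * sqrt (1 + real (\<Sum>k\<in>UNIV. l k))"
      and "\<And>k. k \<in> S \<Longrightarrow> x $ k \<in> {0..1} \<and> y $ k \<in> {0..1} \<and> \<bar>x $ k - y $ k\<bar> \<le> 1 / 2 ^ l k"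
      and "\<And>k. k \<notin> S \<Longrightarrow> \<exists>i < 2 ^ l k. x $ k = real i / 2 ^ l k \<and> y $ k = (real i + 1) / 2 ^ l k"
    for f :: "real ^ 'n \<Rightarrow> real" and \<Gamma> l x y S
  proof -
    have "finite S" by simp
    then show ?thesis using that(4,5)
    proof (induction S arbitrary: l x y)
      case empty
      then have "\<forall>k. \<exists>i < 2 ^ l k. x $ k = real i / 2 ^ l k \<and> y $ k = (real i + 1) / 2 ^ l k"
        by simp
      then obtain i where i: "\<And>k. i k < 2 ^ l k"
        "\<And>k. x $ k = real (i k) / 2 ^ l k \<and> y $ k = (real (i k) + 1) / 2 ^ l k"
        by metis
      have "x = (\<chi> k. real (i k) / 2 ^ l k)" "y = (\<chi> k. (real (i k) + 1) / 2 ^ l k)"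
        using i(2) by (auto simp: vec_eq_iff)
      then show ?case using dyadic[of i l] i(1) by simp
    next
      case (insert k S)
      obtain g where g: "continuous_on UNIV g"
        "\<And>a b. rect_increment (upd y k b) f (upd x k a) = g a - g b"
        using rect_increment_coord[OF f, where k = k and x = x and y = y] by metis
      define A where "A = (\<Prod>j\<in>S. C j) * \<Gamma> * (\<Prod>j\<in>UNIV - {k}. q j ^ l j)"
      define B where "B = real (\<Sum>j\<in>UNIV - {k}. l j)"
      have prod_k: "(\<Prod>j\<in>UNIV. q j ^ (l(k := l')) j) = q k ^ l' * (\<Prod>j\<in>UNIV - {k}. q j ^ l j)" for l'
        by (subst prod.remove[of _ k]) (auto intro!: prod.cong)
      have sum_k: "(\<Sum>j\<in>UNIV. (l(k := l')) j) = l' + (\<Sum>j\<in>UNIV - {k}. l j)" for l'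
        by (subst sum.remove[of _ k]) (auto intro!: sum.cong)
      have "\<bar>g (x $ k) - g (y $ k)\<bar> \<le> C k * (A * q k ^ l k * sqrt (1 + B + real (l k)))"
      proof (rule C[OF g(1)])
        show "0 \<le> A" unfolding A_def
          using q \<Gamma> C0 by (intro mult_nonneg_nonneg prod_nonneg) (auto simp: less_imp_le)
        show "0 \<le> B" unfolding B_def by (rule of_nat_0_le_iff)
        fix l' i :: nat assume i: "i < 2 ^ l'"
        have "\<bar>rect_increment (upd y k ((real i + 1) / 2 ^ l')) f (upd x k (real i / 2 ^ l'))\<bar>
          \<le> (\<Prod>j\<in>S. C j) * \<Gamma> * (\<Prod>j\<in>UNIV. q j ^ (l(k := l')) j)
              * sqrt (1 + real (\<Sum>j\<in>UNIV. (l(k := l')) j))"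
        proof (rule insert.IH)
          show "upd x k (real i / 2 ^ l') $ j \<in> {0..1} \<and> upd y k ((real i + 1) / 2 ^ l') $ j \<in> {0..1} \<and>
              \<bar>upd x k (real i / 2 ^ l') $ j - upd y k ((real i + 1) / 2 ^ l') $ j\<bar> \<le> 1 / 2 ^ (l(k := l')) j"
            if "j \<in> S" for j
          proof -
            have "j \<noteq> k" using that insert.hyps by auto
            then show ?thesis using insert.prems(1)[of j] that by auto
          qed
          show "\<exists>n < 2 ^ (l(k := l')) j. upd x k (real i / 2 ^ l') $ j = real n / 2 ^ (l(k := l')) j \<and>
              upd y k ((real i + 1) / 2 ^ l') $ j = (real n + 1) / 2 ^ (l(k := l')) j"
            if "j \<notin> S" for j
            using insert.prems(2)[of j] that i by (cases "j = k") auto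
        qed
        then show "\<bar>g (real i / 2 ^ l') - g ((real i + 1) / 2 ^ l')\<bar> \<le> A * q k ^ l' * sqrt (1 + B + real l')"
          unfolding g(2) prod_k sum_k A_def B_def by (simp add: mult_ac add_ac)
      qed (use insert.prems(1)[of k] in auto)
      moreover have "rect_increment y f x = g (x $ k) - g (y $ k)"
        using g(2)[of "y $ k" "x $ k"] by simp
      moreover have "C k * (A * q k ^ l k * sqrt (1 + B + real (l k)))
        = (\<Prod>j\<in>insert k S. C j) * \<Gamma> * (\<Prod>j\<in>UNIV. q j ^ l j) * sqrt (1 + real (\<Sum>j\<in>UNIV. l j))"
        using insert.hyps prod_k[of "l k"] sum_k[of "l k"]
        by (simp add: A_def B_def mult_ac add_ac)
      ultimately show ?case by simp
    qed
  qed
  show ?thesis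
  proof (intro exI[of _ "\<Prod>k\<in>UNIV. C k"] conjI allI impI, goal_cases)
    case 1
    show ?case using C0 by (intro prod_nonneg) simp
  next
    case (2 f \<Gamma> l x y)
    show ?case
    proof (rule main[OF 2(1,2)])
      show "\<bar>rect_increment (\<chi> k. (real (i k) + 1) / 2 ^ l k) f (\<chi> k. real (i k) / 2 ^ l k)\<bar>
           \<le> \<Gamma> * (\<Prod>k\<in>UNIV. q k ^ l k) * sqrt (1 + real (\<Sum>k\<in>UNIV. l k))"
        if "\<And>k. i k < 2 ^ l k" for l and i :: "'n \<Rightarrow> nat"
        using 2(3) that by blast
    qed (use 2(4) in auto)
  qed
qed

text \<open>Replace the coordinates of \<open>x, y\<close> by those of \<open>x', y'\<close> one at a time. By additivity each
  replacement costs two boxes having one side at most \<open>2 powr - (m\<^sub>k + r)\<close>, which gains the factor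
  \<open>q\<^sub>0 ^ r\<close> over a box of shape \<open>m\<close>.\<close>

lemma rect_increment_perturbation:
  fixes f :: "real ^ 'n \<Rightarrow> real" and x y x' y' :: "real ^ 'n" and m :: "'n \<Rightarrow> nat"
  assumes f: "continuous_on UNIV f" and K: "0 \<le> K"
    and q: "\<And>k. 0 \<le> q k" "\<And>k. q k \<le> q\<^sub>0"
    and bound: "\<And>l x y. (\<And>k. x $ k \<in> {0..1} \<and> y $ k \<in> {0..1} \<and> \<bar>x $ k - y $ k\<bar> \<le> 1 / 2 ^ l k) \<Longrightarrow>
      \<bar>rect_increment y f x\<bar> \<le> K * (\<Prod>k\<in>UNIV. q k ^ l k) * sqrt (1 + real (\<Sum>k\<in>UNIV. l k))"
    and unit: "\<And>k. x $ k \<in> {0..1} \<and> y $ k \<in> {0..1} \<and> x' $ k \<in> {0..1} \<and> y' $ k \<in> {0..1}"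
    and xy: "\<And>k. \<bar>x $ k - y $ k\<bar> \<le> 1 / 2 ^ m k" and xy': "\<And>k. \<bar>x' $ k - y' $ k\<bar> \<le> 1 / 2 ^ m k"
    and xx': "\<And>k. \<bar>x $ k - x' $ k\<bar> \<le> 1 / 2 ^ (m k + r)"
    and yy': "\<And>k. \<bar>y $ k - y' $ k\<bar> \<le> 1 / 2 ^ (m k + r)"
  shows "\<bar>rect_increment y f x - rect_increment y' f x'\<bar>
    \<le> 2 * real CARD('n) * K * q\<^sub>0 ^ r * (\<Prod>k\<in>UNIV. q k ^ m k) * sqrt (1 + real (\<Sum>k\<in>UNIV. m k) + real r)"
proof -
  define h where "h S u v = (\<chi> i. if i \<in> S then v $ i else u $ i)" for S and u v :: "real ^ 'n"
  have h_nth [simp]: "h S u v $ i = (if i \<in> S then v $ i else u $ i)" for S u v i by (simp add: h_def)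
  define E where "E = K * q\<^sub>0 ^ r * (\<Prod>k\<in>UNIV. q k ^ m k) * sqrt (1 + real (\<Sum>k\<in>UNIV. m k) + real r)"
  have small: "\<bar>rect_increment v f u\<bar> \<le> E"
    if "\<And>j. u $ j \<in> {0..1} \<and> v $ j \<in> {0..1} \<and> \<bar>u $ j - v $ j\<bar> \<le> 1 / 2 ^ m j"
       "\<bar>u $ k - v $ k\<bar> \<le> 1 / 2 ^ (m k + r)" for u v k
  proof -
    have "\<bar>rect_increment v f u\<bar> \<le> K * (\<Prod>j\<in>UNIV. q j ^ (m(k := m k + r)) j)
        * sqrt (1 + real (\<Sum>j\<in>UNIV. (m(k := m k + r)) j))"
      using that by (intro bound) auto
    also have "(\<Prod>j\<in>UNIV. q j ^ (m(k := m k + r)) j) = q k ^ r * (\<Prod>j\<in>UNIV. q j ^ m j)"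
    proof -
      have "(\<Prod>j\<in>UNIV. q j ^ (m(k := m k + r)) j) = q k ^ (m k + r) * (\<Prod>j\<in>UNIV - {k}. q j ^ m j)"
        by (subst prod.remove[of _ k]) (auto intro!: prod.cong)
      moreover have "(\<Prod>j\<in>UNIV. q j ^ m j) = q k ^ m k * (\<Prod>j\<in>UNIV - {k}. q j ^ m j)"
        by (subst prod.remove[of _ k]) auto
      ultimately show ?thesis by (simp add: power_add)
    qed
    also have "(\<Sum>j\<in>UNIV. (m(k := m k + r)) j) = (\<Sum>j\<in>UNIV. m j) + r"
    proof -
      have "(\<Sum>j\<in>UNIV. (m(k := m k + r)) j) = (m k + r) + (\<Sum>j\<in>UNIV - {k}. m j)"
        by (subst sum.remove[of _ k]) (auto intro!: sum.cong)
      moreover have "(\<Sum>j\<in>UNIV. m j) = m k + (\<Sum>j\<in>UNIV - {k}. m j)"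
        by (subst sum.remove[of _ k]) auto
      ultimately show ?thesis by simp
    qed
    also have "K * (q k ^ r * (\<Prod>j\<in>UNIV. q j ^ m j)) * sqrt (1 + real ((\<Sum>j\<in>UNIV. m j) + r)) \<le> E"
      unfolding E_def mult.assoc of_nat_add add.assoc using K q
      by (intro mult_left_mono mult_right_mono power_mono) (auto intro!: mult_nonneg_nonneg prod_nonneg add_nonneg_nonneg sum_nonneg)
    finally show ?thesis .
  qed
  have "\<bar>rect_increment y f x - rect_increment (h S y y') f (h S x x')\<bar> \<le> real (card S) * (2 * E)" for S
  proof -
    have "finite S" by simp
    then show ?thesis
    proof (induction S)
      case empty
      have "h {} u v = u" for u v by (simp add: vec_eq_iff)
      then show ?case by simp
    next
      case (insert k S)
      let ?X = "h S x x'" and ?Y = "h S y y'"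
      obtain g where g: "\<And>a b. rect_increment (upd ?Y k b) f (upd ?X k a) = g a - g b"
        using rect_increment_coord[OF f, where k = k and x = ?X and y = ?Y] by metis
      have "h (insert k S) x x' = upd ?X k (x' $ k)" "h (insert k S) y y' = upd ?Y k (y' $ k)"
        by (auto simp: vec_eq_iff)
      then have 1: "rect_increment (h (insert k S) y y') f (h (insert k S) x x') = g (x' $ k) - g (y' $ k)"
        by (simp add: g)
      have "?X = upd ?X k (x $ k)" "?Y = upd ?Y k (y $ k)"
        using insert.hyps by (auto simp: vec_eq_iff)
      then have 2: "rect_increment ?Y f ?X = g (x $ k) - g (y $ k)"
        using g by metis
      have le: "(1::real) / 2 ^ (m k + r) \<le> 1 / 2 ^ m k"
        by (intro divide_left_mono power_increasing) auto
      have other: "h S x x' $ j \<in> {0..1} \<and> h S y y' $ j \<in> {0..1} \<and> \<bar>h S x x' $ j - h S y y' $ j\<bar> \<le> 1 / 2 ^ m j" for j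
        using unit[of j] xy[of j] xy'[of j] by simp
      have "\<bar>g (x $ k) - g (x' $ k)\<bar> \<le> E"
        unfolding g[symmetric] using other unit[of k] xx'[of k] le
        by (intro small[where k = k]) (auto simp del: h_nth)
      moreover have "\<bar>g (y $ k) - g (y' $ k)\<bar> \<le> E"
        unfolding g[symmetric] using other unit[of k] yy'[of k] le
        by (intro small[where k = k]) (auto simp del: h_nth)
      moreover have "\<bar>rect_increment ?Y f ?X - rect_increment (h (insert k S) y y') f (h (insert k S) x x')\<bar>
          \<le> \<bar>g (x $ k) - g (x' $ k)\<bar> + \<bar>g (y $ k) - g (y' $ k)\<bar>"
        unfolding 1 2 by linarith
      ultimately have "\<bar>rect_increment y f x - rect_increment (h (insert k S) y y') f (h (insert k S) x x')\<bar>
          \<le> real (card S) * (2 * E) + 2 * E"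
        using insert.IH by linarith
      then show ?case using insert.hyps by (simp add: algebra_simps)
    qed
  qed
  from this[of UNIV] have "\<bar>rect_increment y f x - rect_increment y' f x'\<bar> \<le> real CARD('n) * (2 * E)"
    by (simp add: h_def)
  then show ?thesis by (simp add: E_def mult_ac)
qed

lemma dyadic_scale:
  fixes d :: real
  assumes "0 < d" "d \<le> 1"
  shows "\<exists>m::nat. 1 / 2 ^ Suc m < d \<and> d \<le> 1 / 2 ^ m"
proof -
  have "\<exists>n. 1 / 2 ^ n < d"
    using real_arch_pow_inv[of d "1/2"] assms by (auto simp: power_divide)
  define n where "n = (LEAST n. 1 / 2 ^ n < d)"
  have n: "1 / 2 ^ n < d"
    unfolding n_def using \<open>\<exists>n. 1 / 2 ^ n < d\<close> by (rule LeastI_ex)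
  have least: "\<not> 1 / 2 ^ j < d" if "j < n" for j
    using that unfolding n_def by (rule not_less_Least)
  have "n \<noteq> 0" using n assms by (intro notI) simp
  then obtain m where "n = Suc m" by (cases n) auto
  then show ?thesis using n least[of m] by (intro exI[of _ m]) (auto simp: not_less)
qed

text \<open>Rounding the left end point up and the right one down never lengthens the interval, and the two
  points stay in order because the interval is longer than the mesh.\<close>

lemma inward_rounding:
  fixes x y :: real
  assumes "x \<in> {0..1}" "y \<in> {0..1}" and N: "0 < (N::nat)" and d: "1 / real N < \<bar>x - y\<bar>"
  shows "\<exists>a b. a \<le> N \<and> b \<le> N \<and> \<bar>real a / real N - real b / real N\<bar> \<le> \<bar>x - y\<bar>
    \<and> \<bar>x - real a / real N\<bar> \<le> 1 / real N \<and> \<bar>y - real b / real N\<bar> \<le> 1 / real N"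
proof -
  have *: "\<exists>a b. a \<le> N \<and> b \<le> N \<and> \<bar>real a / real N - real b / real N\<bar> \<le> \<bar>x - y\<bar>
    \<and> \<bar>x - real a / real N\<bar> \<le> 1 / real N \<and> \<bar>y - real b / real N\<bar> \<le> 1 / real N"
    if "0 \<le> x" "x < y" "y \<le> 1" "1 / real N < y - x" for x y :: real
  proof -
    define a b where "a = nat \<lceil>real N * x\<rceil>" and "b = nat \<lfloor>real N * y\<rfloor>"
    have a: "real N * x \<le> real a" "real a \<le> real N * x + 1"
      using that N by (auto simp: a_def)
    have b: "real b \<le> real N * y" "real N * y \<le> real b + 1"
      using that N by (auto simp: b_def)
    have gap: "1 < real N * (y - x)" using that(4) N by (simp add: field_simps)
    have "real N * y \<le> real N" using that N by simp
    then have "real b \<le> real N" using b by linarith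
    moreover have ab: "real a \<le> real b"
    proof -
      have "real N * x + 1 < real N * y" using gap by (simp add: algebra_simps)
      then have "\<lceil>real N * x\<rceil> \<le> \<lfloor>real N * y\<rfloor>" by linarith
      then show ?thesis unfolding a_def b_def of_nat_le_iff by (rule nat_mono)
    qed
    moreover have "\<bar>real a / real N - real b / real N\<bar> \<le> \<bar>x - y\<bar>"
    proof -
      have "real N * \<bar>x - y\<bar> = real N * y - real N * x"
        using that by (simp add: algebra_simps)
      then have "\<bar>real a - real b\<bar> \<le> real N * \<bar>x - y\<bar>" using a b ab by linarith
      then have "\<bar>real a - real b\<bar> / real N \<le> \<bar>x - y\<bar>" using N by (simp add: field_simps)
      then show ?thesis by (simp flip: diff_divide_distrib)
    qed
    moreover have "\<bar>u - c / real N\<bar> \<le> 1 / real N" if "\<bar>real N * u - c\<bar> \<le> 1" for u c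
    proof -
      have "u - c / real N = (real N * u - c) / real N" using N by (simp add: field_simps)
      then show ?thesis using that N by (simp add: divide_right_mono)
    qed
    then have "\<bar>x - real a / real N\<bar> \<le> 1 / real N" "\<bar>y - real b / real N\<bar> \<le> 1 / real N"
      using a b by auto
    ultimately show ?thesis
      by (intro exI[of _ a] exI[of _ b]) auto
  qed
  show ?thesis
  proof (cases "x < y")
    case True
    then show ?thesis using *[of x y] assms by simp
  next
    case False
    then have "y < x" using d N by (cases "x = y") auto
    then obtain a b where "a \<le> N \<and> b \<le> N \<and> \<bar>real a / real N - real b / real N\<bar> \<le> \<bar>y - x\<bar>
      \<and> \<bar>y - real a / real N\<bar> \<le> 1 / real N \<and> \<bar>x - real b / real N\<bar> \<le> 1 / real N"
      using *[of y x] assms by auto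
    then show ?thesis by (intro exI[of _ b] exI[of _ a]) (auto simp: abs_minus_commute)
  qed
qed

section \<open>Normalised increments over grid boxes\<close>

text \<open>In each coordinate \<open>k\<close>, a triple \<open>(m, a, b)\<close> stands for the interval between the points \<open>a\<close> and
  \<open>b\<close> of the mesh \<open>2 powr - (m + r)\<close>; \<open>m\<close> records the dyadic scale of the interval that is
  approximated, and degenerate intervals are excluded to keep the variances positive.\<close>

definition grid_index :: "nat \<Rightarrow> ('n::finite \<Rightarrow> nat \<times> nat \<times> nat) set" where
  "grid_index r = {p. \<forall>k. case p k of (m, a, b) \<Rightarrow> a \<le> 2 ^ (m + r) \<and> b \<le> 2 ^ (m + r) \<and> a \<noteq> b}"

definition grid_left :: "nat \<Rightarrow> ('n::finite \<Rightarrow> nat \<times> nat \<times> nat) \<Rightarrow> real ^ 'n" where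
  "grid_left r p = (\<chi> k. case p k of (m, a, b) \<Rightarrow> real a / 2 ^ (m + r))"

definition grid_right :: "nat \<Rightarrow> ('n::finite \<Rightarrow> nat \<times> nat \<times> nat) \<Rightarrow> real ^ 'n" where
  "grid_right r p = (\<chi> k. case p k of (m, a, b) \<Rightarrow> real b / 2 ^ (m + r))"

definition grid_level :: "('n::finite \<Rightarrow> nat \<times> nat \<times> nat) \<Rightarrow> nat" where
  "grid_level p = (\<Sum>k\<in>UNIV. fst (p k))"

definition hurst_volume :: "real ^ 'n \<Rightarrow> real ^ 'n \<Rightarrow> real ^ 'n \<Rightarrow> real" where
  "hurst_volume H x y = (\<Prod>k\<in>UNIV. \<bar>x $ k - y $ k\<bar> powr (H $ k))"

definition grid_increment ::
  "real ^ 'n \<Rightarrow> (real ^ 'n \<Rightarrow> real) \<Rightarrow> nat \<Rightarrow> ('n \<Rightarrow> nat \<times> nat \<times> nat) \<Rightarrow> real" where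
  "grid_increment H f r p =
     rect_increment (grid_right r p) f (grid_left r p) / hurst_volume H (grid_left r p) (grid_right r p)"

lemma hurst_volume_nonneg: "0 \<le> hurst_volume H x y"
  by (simp add: hurst_volume_def prod_nonneg)

lemma hurst_volume_pos: "(\<And>k. x $ k \<noteq> y $ k) \<Longrightarrow> 0 < hurst_volume H x y"
  unfolding hurst_volume_def by (intro prod_pos) simp

lemma hurst_volume_mono:
  assumes "\<And>k. \<bar>x $ k - y $ k\<bar> \<le> \<bar>x' $ k - y' $ k\<bar>" "\<And>k. 0 \<le> H $ k"
  shows "hurst_volume H x y \<le> hurst_volume H x' y'"
  unfolding hurst_volume_def using assms by (intro prod_mono conjI powr_mono2) auto

lemma hurst_volume_dyadic:
  assumes "\<And>k. \<bar>x $ k - y $ k\<bar> = 1 / 2 ^ m k"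
  shows "hurst_volume H x y = (\<Prod>k\<in>UNIV. (2 powr - (H $ k)) ^ m k)"
  unfolding hurst_volume_def
proof (intro prod.cong refl)
  fix k
  have "(1 / 2 ^ m k :: real) = 2 powr - real (m k)"
    by (simp add: powr_minus powr_realpow field_simps)
  then show "\<bar>x $ k - y $ k\<bar> powr (H $ k) = (2 powr - (H $ k)) ^ m k"
    using assms[of k] by (simp add: powr_powr mult.commute powr_power)
qed

text \<open>Each side exceeds half of its dyadic scale, and \<open>2 powr H\<^sub>k \<le> 2\<close>.\<close>

lemma dyadic_le_hurst_volume:
  fixes x y H :: "real ^ 'n"
  assumes H: "\<And>k. 0 < H $ k \<and> H $ k < 1" and m: "\<And>k. 1 / 2 ^ Suc (m k) < \<bar>x $ k - y $ k\<bar>"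
  shows "(\<Prod>k\<in>UNIV. (2 powr - (H $ k)) ^ m k) \<le> 2 ^ CARD('n) * hurst_volume H x y"
proof -
  have "(2 powr - (H $ k)) ^ m k \<le> 2 * \<bar>x $ k - y $ k\<bar> powr (H $ k)" for k
  proof -
    have "(2 powr - (H $ k)) ^ m k = 2 powr (H $ k) * (1 / 2 ^ Suc (m k)) powr (H $ k)"
    proof -
      have "(1 / 2 ^ Suc (m k) :: real) = 2 powr (- real (Suc (m k)))"
        by (simp only: powr_minus powr_realpow zero_less_numeral inverse_eq_divide)
      then have "2 powr (H $ k) * (1 / 2 ^ Suc (m k)) powr (H $ k)
          = 2 powr (H $ k + - real (Suc (m k)) * (H $ k))"
        by (simp only: powr_powr powr_add)
      also have "H $ k + - real (Suc (m k)) * (H $ k) = - (H $ k) * real (m k)"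
        by (simp add: algebra_simps)
      finally show ?thesis by (simp add: powr_power mult.commute)
    qed
    also have "\<dots> \<le> 2 powr 1 * \<bar>x $ k - y $ k\<bar> powr (H $ k)"
      using H[of k] m[of k] by (intro mult_mono powr_mono powr_mono2) auto
    finally show ?thesis by simp
  qed
  then have "(\<Prod>k\<in>UNIV. (2 powr - (H $ k)) ^ m k) \<le> (\<Prod>k\<in>UNIV. 2 * \<bar>x $ k - y $ k\<bar> powr (H $ k))"
    by (intro prod_mono) auto
  then show ?thesis by (simp add: prod.distrib hurst_volume_def)
qed

text \<open>Dyadic boxes are the case \<open>r = 0\<close> of grid boxes.\<close>

lemma dyadic_increment_eq:
  assumes "\<And>k. i k < 2 ^ l k"
  defines "p \<equiv> \<lambda>k. (l k, i k, i k + 1)"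
  shows "p \<in> grid_index 0"
    and "\<bar>rect_increment (\<chi> k. (real (i k) + 1) / 2 ^ l k) f (\<chi> k. real (i k) / 2 ^ l k)\<bar>
      = \<bar>grid_increment H f 0 p\<bar> * (\<Prod>k\<in>UNIV. (2 powr - (H $ k)) ^ l k)"
proof -
  show "p \<in> grid_index 0"
    using assms(1) by (auto simp: p_def grid_index_def less_imp_le Suc_le_eq)
  have eq: "grid_left 0 p = (\<chi> k. real (i k) / 2 ^ l k)"
    "grid_right 0 p = (\<chi> k. (real (i k) + 1) / 2 ^ l k)"
    by (simp_all add: grid_left_def grid_right_def p_def add.commute)
  have d: "\<bar>grid_left 0 p $ k - grid_right 0 p $ k\<bar> = 1 / 2 ^ l k" for k
    unfolding eq by (simp flip: diff_divide_distrib)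
  then have "hurst_volume H (grid_left 0 p) (grid_right 0 p) = (\<Prod>k\<in>UNIV. (2 powr - (H $ k)) ^ l k)"
    by (rule hurst_volume_dyadic)
  moreover have "0 < hurst_volume H (grid_left 0 p) (grid_right 0 p)"
  proof (rule hurst_volume_pos)
    show "grid_left 0 p $ k \<noteq> grid_right 0 p $ k" for k using d[of k] by auto
  qed
  ultimately show "\<bar>rect_increment (\<chi> k. (real (i k) + 1) / 2 ^ l k) f (\<chi> k. real (i k) / 2 ^ l k)\<bar>
      = \<bar>grid_increment H f 0 p\<bar> * (\<Prod>k\<in>UNIV. (2 powr - (H $ k)) ^ l k)"
    by (simp add: grid_increment_def eq)
qed

text \<open>Rounding all sides inwards leaves a grid box of no larger Hurst volume, whose normalised increment
  \<open>G\<close> controls without any loss of constant; the rest is a perturbation. If the rounded box is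
  degenerate, its increment vanishes.\<close>

lemma increment_le_grid:
  fixes f :: "real ^ 'n \<Rightarrow> real" and x y H :: "real ^ 'n"
  assumes f: "continuous_on UNIV f" and H: "\<And>k. 0 < H $ k \<and> H $ k < 1" and K: "0 \<le> K"
    and q\<^sub>0: "\<And>k. 2 powr - (H $ k) \<le> q\<^sub>0"
    and bound: "\<And>l x y. (\<And>k. x $ k \<in> {0..1} \<and> y $ k \<in> {0..1} \<and> \<bar>x $ k - y $ k\<bar> \<le> 1 / 2 ^ l k) \<Longrightarrow>
      \<bar>rect_increment y f x\<bar> \<le> K * (\<Prod>k\<in>UNIV. (2 powr - (H $ k)) ^ l k) * sqrt (1 + real (\<Sum>k\<in>UNIV. l k))"
    and unit: "\<And>k. x $ k \<in> {0..1} \<and> y $ k \<in> {0..1}"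
    and m: "\<And>k. 1 / 2 ^ Suc (m k) < \<bar>x $ k - y $ k\<bar>" "\<And>k. \<bar>x $ k - y $ k\<bar> \<le> 1 / 2 ^ m k"
    and r: "1 \<le> r" and G: "0 \<le> G"
    and grid: "\<And>p. p \<in> grid_index r \<Longrightarrow> (\<And>k. fst (p k) = m k) \<Longrightarrow> \<bar>grid_increment H f r p\<bar> \<le> G"
  shows "\<bar>rect_increment y f x\<bar> \<le> (G + 2 * real CARD('n) * 2 ^ CARD('n) * K * q\<^sub>0 ^ r
      * sqrt (1 + real (\<Sum>k\<in>UNIV. m k) + real r)) * hurst_volume H x y"
proof -
  have "\<exists>a b. a \<le> 2 ^ (m k + r) \<and> b \<le> 2 ^ (m k + r)
      \<and> \<bar>real a / 2 ^ (m k + r) - real b / 2 ^ (m k + r)\<bar> \<le> \<bar>x $ k - y $ k\<bar>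
      \<and> \<bar>x $ k - real a / 2 ^ (m k + r)\<bar> \<le> 1 / 2 ^ (m k + r)
      \<and> \<bar>y $ k - real b / 2 ^ (m k + r)\<bar> \<le> 1 / 2 ^ (m k + r)" for k
  proof -
    have "(1::real) / 2 ^ (m k + r) \<le> 1 / 2 ^ Suc (m k)"
      using r by (intro divide_left_mono power_increasing) auto
    also note m(1)[of k]
    finally show ?thesis
      using inward_rounding[of "x $ k" "y $ k" "2 ^ (m k + r)"] unit[of k] by simp
  qed
  then obtain a b where ab: "\<And>k. a k \<le> 2 ^ (m k + r)" "\<And>k. b k \<le> 2 ^ (m k + r)"
      "\<And>k. \<bar>real (a k) / 2 ^ (m k + r) - real (b k) / 2 ^ (m k + r)\<bar> \<le> \<bar>x $ k - y $ k\<bar>"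
      "\<And>k. \<bar>x $ k - real (a k) / 2 ^ (m k + r)\<bar> \<le> 1 / 2 ^ (m k + r)"
      "\<And>k. \<bar>y $ k - real (b k) / 2 ^ (m k + r)\<bar> \<le> 1 / 2 ^ (m k + r)"
    by metis
  define p where "p k = (m k, a k, b k)" for k
  define x' y' where "x' = grid_left r p" and "y' = grid_right r p"
  have x'y': "x' $ k = real (a k) / 2 ^ (m k + r)" "y' $ k = real (b k) / 2 ^ (m k + r)" for k
    by (simp_all add: x'_def y'_def p_def grid_left_def grid_right_def)
  have unit': "x' $ k \<in> {0..1} \<and> y' $ k \<in> {0..1}" for k
  proof -
    have "real (a k) \<le> real (2 ^ (m k + r))" "real (b k) \<le> real (2 ^ (m k + r))"
      using ab(1,2)[of k] by (simp_all only: of_nat_le_iff)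
    then show ?thesis by (simp add: x'y')
  qed
  have main: "\<bar>rect_increment y' f x'\<bar> \<le> G * hurst_volume H x y"
  proof (cases "\<exists>k. a k = b k")
    case True
    then obtain k where "x' $ k = y' $ k" by (auto simp: x'y')
    then have "rect_increment y' f x' = 0" by (rule rect_increment_eq_0[OF f])
    then show ?thesis using G hurst_volume_nonneg[of H x y] by simp
  next
    case False
    then have p: "p \<in> grid_index r" using ab by (auto simp: grid_index_def p_def)
    have "x' $ k \<noteq> y' $ k" for k using False by (simp add: x'y')
    then have "0 < hurst_volume H x' y'" by (rule hurst_volume_pos)
    then have "\<bar>rect_increment y' f x'\<bar> = \<bar>grid_increment H f r p\<bar> * hurst_volume H x' y'"
      by (simp add: grid_increment_def x'_def y'_def)
    also have "\<dots> \<le> G * hurst_volume H x y"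
      using grid[OF p] ab(3) H G
      by (intro mult_mono hurst_volume_mono hurst_volume_nonneg) (auto simp: p_def x'y' less_imp_le)
    finally show ?thesis .
  qed
  have "\<bar>rect_increment y f x - rect_increment y' f x'\<bar>
    \<le> 2 * real CARD('n) * K * q\<^sub>0 ^ r * (\<Prod>k\<in>UNIV. (2 powr - (H $ k)) ^ m k)
        * sqrt (1 + real (\<Sum>k\<in>UNIV. m k) + real r)"
  proof (rule rect_increment_perturbation[OF f K _ q\<^sub>0 bound])
    show "\<bar>x' $ k - y' $ k\<bar> \<le> 1 / 2 ^ m k" for k
      using ab(3)[of k] m(2)[of k] unfolding x'y' by linarith
  qed (use unit unit' m ab in \<open>auto simp: x'y'\<close>)
  also have "\<dots> \<le> 2 * real CARD('n) * K * q\<^sub>0 ^ r * (2 ^ CARD('n) * hurst_volume H x y)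
        * sqrt (1 + real (\<Sum>k\<in>UNIV. m k) + real r)"
  proof (intro mult_right_mono mult_left_mono dyadic_le_hurst_volume H m(1))
    have "0 \<le> q\<^sub>0" using q\<^sub>0[of undefined] by (meson order_trans powr_ge_zero)
    then show "0 \<le> 2 * real CARD('n) * K * q\<^sub>0 ^ r" using K by simp
    show "0 \<le> sqrt (1 + real (\<Sum>k\<in>UNIV. m k) + real r)" by (simp del: of_nat_sum)
  qed
  finally have "\<bar>rect_increment y f x - rect_increment y' f x'\<bar> \<le> \<dots>" .
  with main have "\<bar>rect_increment y f x\<bar> \<le> G * hurst_volume H x y
    + 2 * real CARD('n) * K * q\<^sub>0 ^ r * (2 ^ CARD('n) * hurst_volume H x y)
        * sqrt (1 + real (\<Sum>k\<in>UNIV. m k) + real r)" by linarith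
  then show ?thesis by (simp add: algebra_simps)
qed

text \<open>The factor \<open>q ^ r\<close> gained by the perturbation beats the growth of the logarithm at mesh \<open>r\<close>.\<close>

lemma rounding_error_tendsto_0:
  fixes q c d L :: real
  assumes "0 < q" "q < 1" and "0 < L" "0 \<le> d"
  shows "(\<lambda>r. c * q ^ r * sqrt ((1 + real r) / L + d)) \<longlonglongrightarrow> 0"
proof (rule Lim_null_comparison)
  define e where "e = \<bar>c\<bar> * (1 / L + d + 1)"
  have "norm (c * q ^ r * sqrt ((1 + real r) / L + d)) \<le> e * (real (Suc r) * q ^ r)" for r
  proof -
    define v where "v = (1 + real r) / L + d"
    have v: "0 \<le> v" using assms by (simp add: v_def)
    then have "sqrt v \<le> v + 1" using arith_geo_mean_sqrt[of v 1] by simp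
    also have "v + 1 = (1 + real r) * (1 / L) + 1 * (d + 1)" by (simp add: v_def)
    also have "\<dots> \<le> (1 + real r) * (1 / L) + (1 + real r) * (d + 1)"
      using assms by (intro add_left_mono mult_right_mono) auto
    also have "\<dots> = (1 + real r) * (1 / L + d + 1)" by (simp add: distrib_left)
    finally have "\<bar>c\<bar> * q ^ r * sqrt v \<le> \<bar>c\<bar> * q ^ r * ((1 + real r) * (1 / L + d + 1))"
      using assms by (intro mult_left_mono) auto
    then show ?thesis using assms v by (simp add: e_def v_def[symmetric] abs_mult mult_ac)
  qed
  then show "\<forall>\<^sub>F r in sequentially. norm (c * q ^ r * sqrt ((1 + real r) / L + d)) \<le> e * (real (Suc r) * q ^ r)"
    by simp
  have "summable (\<lambda>r. real (Suc r) * q ^ r)"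
    using geometric_deriv_sums[of q] assms by (auto simp: sums_iff)
  then show "(\<lambda>r. e * (real (Suc r) * q ^ r)) \<longlonglongrightarrow> 0"
    using tendsto_mult_right_zero summable_LIMSEQ_zero by blast
qed

text \<open>The weight is at most the product of \<open>8 powr - m\<^sub>k\<close> over the coordinates, so the sum is dominated by
  a product of one-dimensional sums. In one coordinate there are at most \<open>(2 ^ (m + r) + 1)\<^sup>2\<close>
  pairs of level \<open>m\<close>, of order \<open>4 ^ m\<close>, and \<open>4 < 8\<close>; this crude count dictates the exponent \<open>3\<close>.\<close>

lemma integrable_grid_weight:
  "integrable (count_space (grid_index r :: ('n::finite \<Rightarrow> nat \<times> nat \<times> nat) set))
     (\<lambda>p. exp (- 3 * max L\<^sub>0 (ln 2 * real (grid_level p))))"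
proof -
  define J where "J = {(m, a, b). a \<le> 2 ^ (m + r) \<and> b \<le> 2 ^ (m + r) \<and> a \<noteq> (b::nat)}"
  define w where "w p = (1 / 8 :: real) ^ fst p" for p :: "nat \<times> nat \<times> nat"
  define A where "A m = {m} \<times> {..(2::nat) ^ (m + r)} \<times> {..(2::nat) ^ (m + r)}" for m :: nat
  have w: "Infinite_Set_Sum.abs_summable_on w J"
  proof -
    have "(\<integral>\<^sup>+p. ennreal (norm (w p)) \<partial>count_space J)
      \<le> (\<integral>\<^sup>+p. \<integral>\<^sup>+m. ennreal ((1/8) ^ m) * indicator (A m) p
            \<partial>count_space UNIV \<partial>count_space J)"
    proof (intro nn_integral_mono)
      fix p assume "p \<in> space (count_space J)"
      then obtain m a b where p: "p = (m, a, b)" "a \<le> 2 ^ (m + r)" "b \<le> 2 ^ (m + r)"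
        by (auto simp: J_def)
      have "ennreal (norm (w p)) = ennreal ((1/8) ^ m) * indicator (A m) p"
        using p by (auto simp: w_def A_def indicator_def)
      also have "\<dots> \<le> (\<integral>\<^sup>+m. ennreal ((1/8) ^ m) * indicator (A m) p
            \<partial>count_space UNIV)"
        by (rule nn_integral_ge_point) simp
      finally show "ennreal (norm (w p)) \<le> \<dots>" .
    qed
    also have "\<dots> = (\<integral>\<^sup>+m. \<integral>\<^sup>+p. ennreal ((1/8) ^ m) * indicator (A m) p
            \<partial>count_space J \<partial>count_space UNIV)"
      by (rule nn_integral_count_space_nn_integral) auto
    also have "\<dots> \<le> (\<integral>\<^sup>+m. ennreal (4 * 4 ^ r * (1/2) ^ m) \<partial>count_space UNIV)"
    proof (intro nn_integral_mono)
      fix m :: nat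
      have finA: "finite (A m)" by (simp add: A_def)
      have "(\<integral>\<^sup>+p. ennreal ((1/8) ^ m) * indicator (A m) p \<partial>count_space J)
          = ennreal ((1/8) ^ m) * (\<integral>\<^sup>+p. indicator (A m \<inter> J) p \<partial>count_space J)"
        by (subst nn_integral_cmult[symmetric]) (auto intro!: nn_integral_cong simp: indicator_def)
      also have "(\<integral>\<^sup>+p. indicator (A m \<inter> J) p \<partial>count_space J) = of_nat (card (A m \<inter> J))"
        using finA by (simp add: emeasure_count_space_finite)
      also have "\<dots> \<le> of_nat (card (A m))" using finA by (intro of_nat_mono card_mono) auto
      also have "card (A m) = (2 ^ (m + r) + 1) * (2 ^ (m + r) + 1)" unfolding A_def by (simp add: card_cartesian_product)
      also have "ennreal ((1/8) ^ m) * of_nat ((2 ^ (m + r) + 1) * (2 ^ (m + r) + 1))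
          = ennreal ((1/8) ^ m * real ((2 ^ (m + r) + 1) * (2 ^ (m + r) + 1)))"
        by (simp only: ennreal_of_nat_eq_real_of_nat ennreal_mult' zero_le_power zero_le_divide_1_iff zero_le_numeral ennreal_mult of_nat_0_le_iff)
      also have "\<dots> \<le> ennreal (4 * 4 ^ r * (1/2) ^ m)"
      proof (intro ennreal_leI)
        have "real ((2 ^ (m + r) + 1) * (2 ^ (m + r) + 1)) \<le> (2 * 2 ^ (m + r)) * (2 * 2 ^ (m + r))"
          unfolding of_nat_mult by (intro mult_mono) auto
        also have "\<dots> = 4 * 4 ^ r * 4 ^ m" by (simp add: power_add power_mult_distrib[symmetric] mult_ac)
        finally have "(1/8) ^ m * real ((2 ^ (m + r) + 1) * (2 ^ (m + r) + 1)) \<le> (1/8) ^ m * (4 * 4 ^ r * 4 ^ m)"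
          by (intro mult_left_mono) auto
        also have "\<dots> = 4 * 4 ^ r * ((1/8) * 4) ^ m" by (simp only: power_mult_distrib mult_ac)
        finally show "(1/8) ^ m * real ((2 ^ (m + r) + 1) * (2 ^ (m + r) + 1)) \<le> 4 * 4 ^ r * (1/2) ^ m"
          by simp
      qed
      finally show "(\<integral>\<^sup>+p. ennreal ((1/8) ^ m) * indicator (A m) p \<partial>count_space J) \<le> ennreal (4 * 4 ^ r * (1/2) ^ m)"
        by (simp add: mult_left_mono)
    qed
    also have "\<dots> < \<infinity>"
    proof -
      have "summable (\<lambda>m. 4 * 4 ^ r * (1/2 :: real) ^ m)" by (intro summable_mult summable_geometric) simp
      then show ?thesis
        by (simp add: nn_integral_count_space_nat suminf_ennreal2 less_top[symmetric])
    qed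
    finally show ?thesis unfolding abs_summable_on_def by (intro integrableI_bounded) auto
  qed
  have J: "countable J" by (rule countableI_type)
  have "Infinite_Set_Sum.abs_summable_on (\<lambda>p. \<Prod>k\<in>(UNIV::'n set). w (p k)) (PiE UNIV (\<lambda>_. J))"
    by (rule abs_summable_on_prod_PiE) (use w J in auto)
  also have "PiE UNIV (\<lambda>_. J) = grid_index r"
    by (auto simp: grid_index_def J_def PiE_def Pi_def split: prod.splits)
  finally have int: "integrable (count_space (grid_index r)) (\<lambda>p. \<Prod>k\<in>(UNIV::'n set). w (p k))"
    by (simp add: abs_summable_on_def)
  show ?thesis
  proof (rule Bochner_Integration.integrable_bound[OF int])
    show "AE p in count_space (grid_index r). norm (exp (- 3 * max L\<^sub>0 (ln 2 * real (grid_level p))))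
      \<le> norm (\<Prod>k\<in>(UNIV::'n set). w (p k))"
    proof (rule AE_I2)
      fix p :: "'n \<Rightarrow> nat \<times> nat \<times> nat"
      have "exp (- 3 * max L\<^sub>0 (ln 2 * real (grid_level p))) \<le> exp (real (grid_level p) * (- 3 * ln 2))"
        by (simp add: mult.commute)
      also have "\<dots> = exp (- 3 * ln 2) ^ grid_level p" by (rule exp_of_nat_mult)
      also have "exp (- 3 * ln 2 :: real) = 1 / 8"
      proof -
        have "exp (- 3 * ln 2 :: real) = 1 / exp (3 * ln 2)" by (simp add: exp_minus field_simps)
        also have "exp (3 * ln 2 :: real) = exp (ln 2) ^ 3" using exp_of_nat_mult[of 3 "ln 2 :: real"] by simp
        finally show ?thesis by simp
      qed
      also have "(1 / 8) ^ grid_level p = (\<Prod>k\<in>UNIV. w (p k))"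
        by (simp add: grid_level_def power_sum w_def case_prod_unfold)
      finally show "norm (exp (- 3 * max L\<^sub>0 (ln 2 * real (grid_level p)))) \<le> norm (\<Prod>k\<in>UNIV. w (p k))"
        by (simp add: case_prod_unfold w_def prod_nonneg)
    qed
  qed simp
qed

section \<open>The modulus of continuity\<close>

lemma modulus_pos:
  assumes "\<And>k. x $ k \<noteq> y $ k" "(\<Prod>j\<in>UNIV. \<bar>x $ j - y $ j\<bar>) < 1"
  shows "0 < modulus H x y"
proof -
  have "0 < (\<Prod>j\<in>UNIV. \<bar>x $ j - y $ j\<bar>)" using assms(1) by (intro prod_pos) simp
  then have "ln (\<Prod>j\<in>UNIV. \<bar>x $ j - y $ j\<bar>) < 0" using assms(2) by simp
  then show ?thesis
    using hurst_volume_pos[of x y H] assms(1) by (simp add: modulus_def hurst_volume_def)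
qed

text \<open>If \<open>x\<close> and \<open>y\<close> share a coordinate, the increment vanishes and the quotient is \<open>0 / 0 = 0\<close>.\<close>

lemma increment_ratio_sup_le:
  fixes f :: "real ^ 'n \<Rightarrow> real"
  assumes f: "continuous_on UNIV f" and B: "0 \<le> B"
    and bound: "\<And>x y. (\<And>k. x $ k \<in> {0..1} \<and> y $ k \<in> {0..1}) \<Longrightarrow> norm (x - y) \<le> \<delta> \<Longrightarrow>
      (\<And>k. x $ k \<noteq> y $ k) \<Longrightarrow> 0 < modulus H x y \<and> \<bar>rect_increment y f x\<bar> \<le> B * modulus H x y"
  shows "increment_ratio_sup H f \<delta> \<le> ereal B"
  unfolding increment_ratio_sup_def
proof (rule SUP_least, clarify)
  fix x y :: "real ^ 'n"
  assume xy: "x \<in> cbox 0 1" "y \<in> cbox 0 1" "norm (x - y) \<le> \<delta>"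
  show "ereal \<bar>rect_increment y f x\<bar> / ereal (modulus H x y) \<le> ereal B"
  proof (cases "\<exists>k. x $ k = y $ k")
    case True
    then have "rect_increment y f x = 0" using rect_increment_eq_0[OF f] by blast
    then show ?thesis using B by (simp add: divide_ereal_def)
  next
    case False
    have "x $ k \<in> {0..1} \<and> y $ k \<in> {0..1}" for k
      using xy by (simp add: mem_box_cart)
    then have "0 < modulus H x y \<and> \<bar>rect_increment y f x\<bar> \<le> B * modulus H x y"
      using False xy(3) by (intro bound) auto
    then show ?thesis by (simp add: field_simps)
  qed
qed

lemma increment_ratio_sup_mono:
  assumes "\<delta> \<le> \<delta>'"
  shows "increment_ratio_sup H f \<delta> \<le> increment_ratio_sup H f \<delta>'"
  unfolding increment_ratio_sup_def using assms by (intro SUP_subset_mono) auto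

text \<open>The arithmetic-geometric mean inequality for the squares of the sides.\<close>

lemma prod_le_of_norm_le:
  fixes x y :: "real ^ 'n"
  assumes "norm (x - y) \<le> \<delta>"
  shows "(\<Prod>k\<in>UNIV. \<bar>x $ k - y $ k\<bar>) \<le> (\<delta> / sqrt (real CARD('n))) ^ CARD('n)"
proof -
  define n where "n = CARD('n)"
  have n: "0 < n" by (simp add: n_def)
  have \<delta>: "0 \<le> \<delta>" using assms norm_ge_zero order_trans by blast
  define P where "P = (\<Prod>k\<in>UNIV. (x $ k - y $ k)\<^sup>2)"
  have P0: "0 \<le> P" by (simp add: P_def prod_nonneg)
  have "P powr (1 / real n) \<le> (\<Sum>k\<in>UNIV. (x $ k - y $ k)\<^sup>2 / real n)"
    unfolding P_def n_def by (rule arith_geom_mean) auto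
  also have "\<dots> = (norm (x - y))\<^sup>2 / real n"
    by (simp add: norm_vec_def L2_set_def sum_nonneg sum_divide_distrib)
  also have "\<dots> \<le> \<delta>\<^sup>2 / real n" using assms by (intro divide_right_mono power_mono) auto
  also have "\<dots> = (\<delta> / sqrt (real n))\<^sup>2" by (simp add: power_divide)
  finally have "(P powr (1 / real n)) ^ n \<le> ((\<delta> / sqrt (real n))\<^sup>2) ^ n"
    by (intro power_mono) auto
  moreover have "(P powr (1 / real n)) ^ n = P"
    using n P0 by (cases "P = 0") (auto simp: powr_powr simp flip: powr_realpow)
  moreover have "P = (\<Prod>k\<in>UNIV. \<bar>x $ k - y $ k\<bar>)\<^sup>2"
    by (simp add: P_def flip: prod_power_distrib abs_prod)
  ultimately have "(\<Prod>k\<in>UNIV. \<bar>x $ k - y $ k\<bar>)\<^sup>2 \<le> ((\<delta> / sqrt (real n)) ^ n)\<^sup>2"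
    by (simp add: mult.commute flip: power_mult)
  then show ?thesis unfolding n_def
    by (rule power2_le_imp_le) (use \<delta> in simp)
qed

text \<open>The deterministic core. Only grid boxes compatible with \<open>\<delta>\<close> enter the hypothesis on \<open>G\<close>, so that
  for small \<open>\<delta>\<close> any finite set of exceptional boxes is irrelevant. If a box of volume
  \<open>P \<le> exp (- L\<^sub>0)\<close> has shape \<open>m\<close>, then \<open>P \<le> 2 powr - (\<Sum>k. m\<^sub>k)\<close>, hence \<open>\<bar>ln P\<bar>\<close> is at least
  \<open>L = max L\<^sub>0 (ln 2 * (\<Sum>k. m\<^sub>k))\<close>, and the rounding error at shape \<open>m\<close> is at most
  \<open>\<epsilon>\<^sub>r * \<Gamma> * sqrt L\<close> uniformly in \<open>m\<close>. The sequence \<open>\<epsilon>\<close> depends on \<open>H\<close> and \<open>L\<^sub>0\<close>, but not on the path.\<close>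

lemma increment_ratio_sup_grid_bound:
  fixes H :: "real ^ 'n"
  assumes H: "\<And>k. 0 < H $ k \<and> H $ k < 1" and L\<^sub>0: "0 < L\<^sub>0"
  obtains \<epsilon> :: "nat \<Rightarrow> real" where "\<epsilon> \<longlonglongrightarrow> 0" "\<And>r. 0 \<le> \<epsilon> r"
    and "\<And>r f \<Gamma> G \<delta>. 1 \<le> r \<Longrightarrow> continuous_on UNIV f \<Longrightarrow> 0 \<le> \<Gamma> \<Longrightarrow> 0 \<le> G \<Longrightarrow>
      (\<And>p. p \<in> grid_index 0 \<Longrightarrow> \<bar>grid_increment H f 0 p\<bar> \<le> \<Gamma> * sqrt (max 1 (ln 2 * real (grid_level p)))) \<Longrightarrow>
      (\<And>p. p \<in> grid_index r \<Longrightarrow> (\<And>k. 1 / 2 ^ Suc (fst (p k)) < \<delta>) \<Longrightarrow>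
        \<bar>grid_increment H f r p\<bar> \<le> G * sqrt (max L\<^sub>0 (ln 2 * real (grid_level p)))) \<Longrightarrow>
      (\<And>x y :: real ^ 'n. (\<And>k. x $ k \<in> {0..1} \<and> y $ k \<in> {0..1}) \<Longrightarrow> norm (x - y) \<le> \<delta> \<Longrightarrow>
        (\<Prod>k\<in>UNIV. \<bar>x $ k - y $ k\<bar>) \<le> exp (- L\<^sub>0)) \<Longrightarrow>
      increment_ratio_sup H f \<delta> \<le> ereal (G + \<epsilon> r * \<Gamma>)"
proof -
  define q where "q k = 2 powr - (H $ k)" for k
  have q: "0 < q k" "q k < 1" for k
    using H[of k] by (auto simp: q_def powr_less_one)
  define q\<^sub>0 where "q\<^sub>0 = Max (range q)"
  have q\<^sub>0_ge: "q k \<le> q\<^sub>0" for k by (simp add: q\<^sub>0_def)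
  have "q\<^sub>0 \<in> range q" unfolding q\<^sub>0_def by (rule Max_in) auto
  then have q\<^sub>0: "0 < q\<^sub>0" "q\<^sub>0 < 1" using q by auto
  obtain C where C0: "0 \<le> C" and C: "\<And>(f :: real ^ 'n \<Rightarrow> real) \<Gamma> l x y. continuous_on UNIV f \<Longrightarrow> 0 \<le> \<Gamma> \<Longrightarrow>
      (\<And>l i. (\<And>k. i k < 2 ^ l k) \<Longrightarrow>
         \<bar>rect_increment (\<chi> k. (real (i k) + 1) / 2 ^ l k) f (\<chi> k. real (i k) / 2 ^ l k)\<bar>
           \<le> \<Gamma> * (\<Prod>k\<in>UNIV. q k ^ l k) * sqrt (1 + real (\<Sum>k\<in>UNIV. l k))) \<Longrightarrow>
      (\<And>k. x $ k \<in> {0..1} \<and> y $ k \<in> {0..1} \<and> \<bar>x $ k - y $ k\<bar> \<le> 1 / 2 ^ l k) \<Longrightarrow>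
      \<bar>rect_increment y f x\<bar> \<le> C * \<Gamma> * (\<Prod>k\<in>UNIV. q k ^ l k) * sqrt (1 + real (\<Sum>k\<in>UNIV. l k))"
    using rect_increment_chaining[of q] q by blast
  define \<epsilon> where "\<epsilon> r = 2 * real CARD('n) * 2 ^ CARD('n) * C * q\<^sub>0 ^ r
      * sqrt ((1 + real r) / L\<^sub>0 + 1 / ln 2)" for r :: nat
  show thesis
  proof (rule that)
    show "\<epsilon> \<longlonglongrightarrow> 0" unfolding \<epsilon>_def using q\<^sub>0 L\<^sub>0 by (intro rounding_error_tendsto_0) auto
    show "0 \<le> \<epsilon> r" for r
      unfolding \<epsilon>_def using C0 q\<^sub>0 L\<^sub>0 by simp
    fix r f \<Gamma> G \<delta>
    assume r: "1 \<le> r" and f: "continuous_on UNIV f" and \<Gamma>: "0 \<le> \<Gamma>" and G: "0 \<le> G"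
      and dyadic: "\<And>p. p \<in> grid_index 0 \<Longrightarrow> \<bar>grid_increment H f 0 p\<bar> \<le> \<Gamma> * sqrt (max 1 (ln 2 * real (grid_level p)))"
      and grid: "\<And>p. p \<in> grid_index r \<Longrightarrow> (\<And>k. 1 / 2 ^ Suc (fst (p k)) < \<delta>) \<Longrightarrow>
        \<bar>grid_increment H f r p\<bar> \<le> G * sqrt (max L\<^sub>0 (ln 2 * real (grid_level p)))"
      and small: "\<And>x y :: real ^ 'n. (\<And>k. x $ k \<in> {0..1} \<and> y $ k \<in> {0..1}) \<Longrightarrow> norm (x - y) \<le> \<delta> \<Longrightarrow>
        (\<Prod>k\<in>UNIV. \<bar>x $ k - y $ k\<bar>) \<le> exp (- L\<^sub>0)"
    have bound: "\<bar>rect_increment y f x\<bar> \<le> C * \<Gamma> * (\<Prod>k\<in>UNIV. q k ^ l k) * sqrt (1 + real (\<Sum>k\<in>UNIV. l k))"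
      if "\<And>k. x $ k \<in> {0..1} \<and> y $ k \<in> {0..1} \<and> \<bar>x $ k - y $ k\<bar> \<le> 1 / 2 ^ l k" for l x y
    proof (rule C[OF f \<Gamma> _ that])
      fix l i :: "'n \<Rightarrow> nat" assume i: "\<And>k. i k < 2 ^ l k"
      define p where "p k = (l k, i k, i k + 1)" for k
      have p: "p \<in> grid_index 0" unfolding p_def using i by (rule dyadic_increment_eq(1))
      have level: "grid_level p = (\<Sum>k\<in>UNIV. l k)" by (simp add: grid_level_def p_def)
      have "\<bar>grid_increment H f 0 p\<bar> \<le> \<Gamma> * sqrt (max 1 (ln 2 * real (grid_level p)))"
        by (rule dyadic[OF p])
      also have "\<dots> \<le> \<Gamma> * sqrt (1 + real (\<Sum>k\<in>UNIV. l k))"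
      proof (intro mult_left_mono real_sqrt_le_mono \<Gamma>)
        have "ln 2 * real (grid_level p) \<le> 1 * real (grid_level p)"
          using ln_2_less_1 by (intro mult_right_mono) auto
        then show "max 1 (ln 2 * real (grid_level p)) \<le> 1 + real (\<Sum>k\<in>UNIV. l k)"
          unfolding level by (simp del: of_nat_sum)
      qed
      finally have "\<bar>grid_increment H f 0 p\<bar> * (\<Prod>k\<in>UNIV. q k ^ l k)
          \<le> \<Gamma> * sqrt (1 + real (\<Sum>k\<in>UNIV. l k)) * (\<Prod>k\<in>UNIV. q k ^ l k)"
        using q by (intro mult_right_mono prod_nonneg) (auto simp: less_imp_le)
      moreover have "\<bar>rect_increment (\<chi> k. (real (i k) + 1) / 2 ^ l k) f (\<chi> k. real (i k) / 2 ^ l k)\<bar>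
          = \<bar>grid_increment H f 0 p\<bar> * (\<Prod>k\<in>UNIV. q k ^ l k)"
        unfolding p_def q_def using i by (rule dyadic_increment_eq(2))
      ultimately show "\<bar>rect_increment (\<chi> k. (real (i k) + 1) / 2 ^ l k) f (\<chi> k. real (i k) / 2 ^ l k)\<bar>
          \<le> \<Gamma> * (\<Prod>k\<in>UNIV. q k ^ l k) * sqrt (1 + real (\<Sum>k\<in>UNIV. l k))"
        by (simp only: mult_ac)
    qed
    show "increment_ratio_sup H f \<delta> \<le> ereal (G + \<epsilon> r * \<Gamma>)"
    proof (rule increment_ratio_sup_le[OF f])
      show "0 \<le> G + \<epsilon> r * \<Gamma>" using G \<Gamma> \<open>\<And>r. 0 \<le> \<epsilon> r\<close> by simp
      fix x y :: "real ^ 'n"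
      assume unit: "\<And>k. x $ k \<in> {0..1} \<and> y $ k \<in> {0..1}" and norm: "norm (x - y) \<le> \<delta>"
        and ne: "\<And>k. x $ k \<noteq> y $ k"
      define P where "P = (\<Prod>k\<in>UNIV. \<bar>x $ k - y $ k\<bar>)"
      have P0: "0 < P" unfolding P_def using ne by (intro prod_pos) simp
      have P_le: "P \<le> exp (- L\<^sub>0)" unfolding P_def using small unit norm by blast
      moreover have "exp (- L\<^sub>0) < 1" using L\<^sub>0 by simp
      ultimately have "P < 1" by linarith
      then have pos: "0 < modulus H x y"
        unfolding P_def using ne by (intro modulus_pos)
      have "\<exists>m. 1 / 2 ^ Suc m < \<bar>x $ k - y $ k\<bar> \<and> \<bar>x $ k - y $ k\<bar> \<le> 1 / 2 ^ m" for k
        using dyadic_scale[of "\<bar>x $ k - y $ k\<bar>"] ne[of k] unit[of k] by auto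
      then obtain m where m: "\<And>k. 1 / 2 ^ Suc (m k) < \<bar>x $ k - y $ k\<bar>"
        "\<And>k. \<bar>x $ k - y $ k\<bar> \<le> 1 / 2 ^ m k" by metis
      define s where "s = real (\<Sum>k\<in>UNIV. m k)"
      define L where "L = max L\<^sub>0 (ln 2 * s)"
      have L_pos: "0 < L" using L\<^sub>0 by (simp add: L_def)
      have L_le: "L \<le> \<bar>ln P\<bar>"
      proof -
        have "P \<le> (\<Prod>k\<in>UNIV. 1 / 2 ^ m k)"
          unfolding P_def using m(2) by (intro prod_mono) auto
        also have "\<dots> = (1 / 2) ^ (\<Sum>k\<in>UNIV. m k)" by (simp add: power_sum power_divide)
        finally have "ln P \<le> ln ((1 / 2) ^ (\<Sum>k\<in>UNIV. m k))" using P0 by simp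
        also have "\<dots> = - (ln 2 * s)" by (simp add: ln_realpow s_def ln_div)
        finally have 1: "ln P \<le> - (ln 2 * s)" .
        have "ln P \<le> - L\<^sub>0" using P_le P0 by (metis ln_exp ln_le_cancel_iff exp_gt_zero)
        with 1 have "L \<le> - ln P" by (simp add: L_def)
        then show ?thesis by linarith
      qed
      have "\<bar>rect_increment y f x\<bar> \<le> (G * sqrt L + 2 * real CARD('n) * 2 ^ CARD('n) * (C * \<Gamma>) * q\<^sub>0 ^ r
          * sqrt (1 + s + real r)) * hurst_volume H x y"
        unfolding s_def
      proof (rule increment_le_grid[OF f H _ _ _ unit m r])
        show "0 \<le> C * \<Gamma>" using C0 \<Gamma> by simp
        show "2 powr - (H $ k) \<le> q\<^sub>0" for k using q\<^sub>0_ge[of k] by (simp add: q_def)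
        show "\<bar>rect_increment y f x\<bar> \<le> C * \<Gamma> * (\<Prod>k\<in>UNIV. (2 powr - (H $ k)) ^ l k)
            * sqrt (1 + real (\<Sum>k\<in>UNIV. l k))"
          if "\<And>k. x $ k \<in> {0..1} \<and> y $ k \<in> {0..1} \<and> \<bar>x $ k - y $ k\<bar> \<le> 1 / 2 ^ l k" for l x y
          using bound[of x y l] that unfolding q_def by blast
        show "0 \<le> G * sqrt L" using G L_pos by simp
        fix p :: "'n \<Rightarrow> nat \<times> nat \<times> nat"
        assume p: "p \<in> grid_index r" and pm: "\<And>k. fst (p k) = m k"
        have "1 / 2 ^ Suc (fst (p k)) < \<delta>" for k
        proof -
          have "1 / 2 ^ Suc (fst (p k)) < \<bar>(x - y) $ k\<bar>" using m(1)[of k] pm[of k] by simp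
          also have "\<dots> \<le> norm (x - y)" by (rule component_le_norm_cart)
          finally show ?thesis using norm by simp
        qed
        then have "\<bar>grid_increment H f r p\<bar> \<le> G * sqrt (max L\<^sub>0 (ln 2 * real (grid_level p)))"
          by (rule grid[OF p])
        then show "\<bar>grid_increment H f r p\<bar> \<le> G * sqrt L"
          by (simp add: L_def s_def grid_level_def pm)
      qed
      also have "\<dots> \<le> (G * sqrt L + 2 * real CARD('n) * 2 ^ CARD('n) * (C * \<Gamma>) * q\<^sub>0 ^ r
          * (sqrt ((1 + real r) / L\<^sub>0 + 1 / ln 2) * sqrt L)) * hurst_volume H x y"
      proof (intro mult_right_mono add_left_mono mult_left_mono hurst_volume_nonneg)
        have "L\<^sub>0 \<le> L" "ln 2 * s \<le> L" by (simp_all add: L_def)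
        then have "1 + real r \<le> (1 + real r) / L\<^sub>0 * L" "s \<le> 1 / ln 2 * L"
          using L\<^sub>0 mult_left_mono[of L\<^sub>0 L "1 + real r"] by (simp_all add: field_simps)
        then have "1 + s + real r \<le> ((1 + real r) / L\<^sub>0 + 1 / ln 2) * L"
          by (simp add: distrib_right)
        then have "sqrt (1 + s + real r) \<le> sqrt (((1 + real r) / L\<^sub>0 + 1 / ln 2) * L)"
          by (rule real_sqrt_le_mono)
        then show "sqrt (1 + s + real r) \<le> sqrt ((1 + real r) / L\<^sub>0 + 1 / ln 2) * sqrt L"
          by (simp only: real_sqrt_mult)
      qed (use C0 \<Gamma> q\<^sub>0 in simp)
      also have "\<dots> = (G + \<epsilon> r * \<Gamma>) * (hurst_volume H x y * sqrt L)"
        by (simp add: \<epsilon>_def algebra_simps)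
      also have "\<dots> \<le> (G + \<epsilon> r * \<Gamma>) * modulus H x y"
        unfolding modulus_def hurst_volume_def[symmetric] P_def[symmetric]
        using L_le G \<Gamma> \<open>\<And>r. 0 \<le> \<epsilon> r\<close>
        by (intro mult_left_mono real_sqrt_le_mono hurst_volume_nonneg) auto
      finally show "0 < modulus H x y \<and> \<bar>rect_increment y f x\<bar> \<le> (G + \<epsilon> r * \<Gamma>) * modulus H x y"
        using pos by blast
    qed
  qed
qed

lemma grid_increment_bound:
  fixes H :: "real ^ 'n"
  assumes fbf: "continuous_fbf M H W" and H: "\<And>k. 0 < H $ k"
    and L\<^sub>0: "0 < L\<^sub>0" and \<theta>: "0 < \<theta>" "\<theta> < 1"
  obtains G where "G \<in> borel_measurable M" "\<And>\<omega>. 0 \<le> G \<omega>"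
    and "AE \<omega> in M. \<forall>p\<in>grid_index r. \<bar>grid_increment H (\<lambda>z. W z \<omega>) r p\<bar>
      \<le> G \<omega> * sqrt (max L\<^sub>0 (ln 2 * real (grid_level p)))"
    and "AE \<omega> in M. finite {p\<in>grid_index r. sqrt (2 * 3 / \<theta>) * sqrt (max L\<^sub>0 (ln 2 * real (grid_level p)))
      < \<bar>grid_increment H (\<lambda>z. W z \<omega>) r p\<bar>}"
    and "\<And>\<alpha>. 0 \<le> \<alpha> \<Longrightarrow> 2 * \<alpha> \<le> \<theta> * L\<^sub>0 \<Longrightarrow> integrable M (\<lambda>\<omega>. exp (\<alpha> * (G \<omega>)\<^sup>2))"
proof (rule gaussian_family_bound[where I = "grid_index r" and t = 3 and \<theta> = \<theta> and L\<^sub>0 = L\<^sub>0 and M = M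
      and \<xi> = "\<lambda>p \<omega>. grid_increment H (\<lambda>z. W z \<omega>) r p"
      and L = "\<lambda>p. max L\<^sub>0 (ln 2 * real (grid_level p))"])
  show "prob_space M" using fbf by (simp add: continuous_fbf_def)
  fix p :: "'n \<Rightarrow> nat \<times> nat \<times> nat" assume p: "p \<in> grid_index r"
  have ne: "grid_left r p $ k \<noteq> grid_right r p $ k" for k
    using p by (auto simp: grid_index_def grid_left_def grid_right_def split: prod.splits dest!: spec[of _ k])
  note normal = normalized_rect_increment[OF fbf H ne]
  show "gaussian_rv M (\<lambda>\<omega>. grid_increment H (\<lambda>z. W z \<omega>) r p)"
    "prob_space.expectation M (\<lambda>\<omega>. grid_increment H (\<lambda>z. W z \<omega>) r p) = 0"
    "prob_space.expectation M (\<lambda>\<omega>. (grid_increment H (\<lambda>z. W z \<omega>) r p)\<^sup>2) = 1"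
    using normal by (simp_all add: grid_increment_def hurst_volume_def)
qed (use that L\<^sub>0 \<theta> integrable_grid_weight in \<open>auto intro: countableI_type\<close>)

text \<open>Either \<open>X + Y \<le> \<eta> X\<close> or \<open>X + Y \<le> \<eta> / (\<eta> - 1) * Y\<close>. Thus with \<open>\<eta>\<close> close to \<open>1\<close>
  the exponent available for \<open>X\<close> is almost kept, provided that \<open>Y\<close> has a sufficiently large one.\<close>

lemma integrable_exp_square_sum:
  fixes X Y :: "'a \<Rightarrow> real"
  assumes [measurable]: "X \<in> borel_measurable M" "Y \<in> borel_measurable M"
    and nonneg: "\<And>\<omega>. 0 \<le> X \<omega>" "\<And>\<omega>. 0 \<le> Y \<omega>" and "0 \<le> \<alpha>" and \<eta>: "1 < \<eta>"
    and int: "integrable M (\<lambda>\<omega>. exp (\<alpha> * \<eta>\<^sup>2 * (X \<omega>)\<^sup>2))"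
      "integrable M (\<lambda>\<omega>. exp (\<alpha> * (\<eta> / (\<eta> - 1))\<^sup>2 * (Y \<omega>)\<^sup>2))"
  shows "integrable M (\<lambda>\<omega>. exp (\<alpha> * (X \<omega> + Y \<omega>)\<^sup>2))"
proof (rule Bochner_Integration.integrable_bound)
  show "integrable M (\<lambda>\<omega>. exp (\<alpha> * \<eta>\<^sup>2 * (X \<omega>)\<^sup>2) + exp (\<alpha> * (\<eta> / (\<eta> - 1))\<^sup>2 * (Y \<omega>)\<^sup>2))"
    using int by simp
  show "AE \<omega> in M. norm (exp (\<alpha> * (X \<omega> + Y \<omega>)\<^sup>2))
      \<le> norm (exp (\<alpha> * \<eta>\<^sup>2 * (X \<omega>)\<^sup>2) + exp (\<alpha> * (\<eta> / (\<eta> - 1))\<^sup>2 * (Y \<omega>)\<^sup>2))"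
  proof (rule AE_I2)
    fix \<omega>
    consider "X \<omega> + Y \<omega> \<le> \<eta> * X \<omega>" | "X \<omega> + Y \<omega> \<le> \<eta> / (\<eta> - 1) * Y \<omega>"
    proof (cases "Y \<omega> \<le> (\<eta> - 1) * X \<omega>")
      case True
      then show ?thesis using that(1) by (simp add: algebra_simps)
    next
      case False
      then have "X \<omega> \<le> Y \<omega> / (\<eta> - 1)" using \<eta> by (simp add: field_simps)
      moreover have "Y \<omega> / (\<eta> - 1) + Y \<omega> = \<eta> / (\<eta> - 1) * Y \<omega>" using \<eta> by (simp add: field_simps)
      ultimately show ?thesis using that(2) by linarith
    qed
    then have "\<alpha> * (X \<omega> + Y \<omega>)\<^sup>2 \<le> \<alpha> * \<eta>\<^sup>2 * (X \<omega>)\<^sup>2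
      \<or> \<alpha> * (X \<omega> + Y \<omega>)\<^sup>2 \<le> \<alpha> * (\<eta> / (\<eta> - 1))\<^sup>2 * (Y \<omega>)\<^sup>2"
    proof cases
      case 1
      then have "(X \<omega> + Y \<omega>)\<^sup>2 \<le> (\<eta> * X \<omega>)\<^sup>2" using nonneg by (intro power_mono) auto
      then have "\<alpha> * (X \<omega> + Y \<omega>)\<^sup>2 \<le> \<alpha> * (\<eta> * X \<omega>)\<^sup>2" using \<open>0 \<le> \<alpha>\<close> by (rule mult_left_mono)
      then show ?thesis by (simp add: power_mult_distrib)
    next
      case 2
      then have "(X \<omega> + Y \<omega>)\<^sup>2 \<le> (\<eta> / (\<eta> - 1) * Y \<omega>)\<^sup>2" using nonneg by (intro power_mono) auto
      then have "\<alpha> * (X \<omega> + Y \<omega>)\<^sup>2 \<le> \<alpha> * (\<eta> / (\<eta> - 1) * Y \<omega>)\<^sup>2" using \<open>0 \<le> \<alpha>\<close> by (rule mult_left_mono)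
      then show ?thesis unfolding power_mult_distrib mult.assoc by blast
    qed
    then show "norm (exp (\<alpha> * (X \<omega> + Y \<omega>)\<^sup>2))
      \<le> norm (exp (\<alpha> * \<eta>\<^sup>2 * (X \<omega>)\<^sup>2) + exp (\<alpha> * (\<eta> / (\<eta> - 1))\<^sup>2 * (Y \<omega>)\<^sup>2))"
    proof
      assume "\<alpha> * (X \<omega> + Y \<omega>)\<^sup>2 \<le> \<alpha> * \<eta>\<^sup>2 * (X \<omega>)\<^sup>2"
      then have "exp (\<alpha> * (X \<omega> + Y \<omega>)\<^sup>2) \<le> exp (\<alpha> * \<eta>\<^sup>2 * (X \<omega>)\<^sup>2)" by simp
      also have "\<dots> \<le> exp (\<alpha> * \<eta>\<^sup>2 * (X \<omega>)\<^sup>2) + exp (\<alpha> * (\<eta> / (\<eta> - 1))\<^sup>2 * (Y \<omega>)\<^sup>2)" by simp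
      finally show ?thesis by simp
    next
      assume "\<alpha> * (X \<omega> + Y \<omega>)\<^sup>2 \<le> \<alpha> * (\<eta> / (\<eta> - 1))\<^sup>2 * (Y \<omega>)\<^sup>2"
      then have "exp (\<alpha> * (X \<omega> + Y \<omega>)\<^sup>2) \<le> exp (\<alpha> * (\<eta> / (\<eta> - 1))\<^sup>2 * (Y \<omega>)\<^sup>2)" by simp
      also have "\<dots> \<le> exp (\<alpha> * \<eta>\<^sup>2 * (X \<omega>)\<^sup>2) + exp (\<alpha> * (\<eta> / (\<eta> - 1))\<^sup>2 * (Y \<omega>)\<^sup>2)" by simp
      finally show ?thesis by simp
    qed
  qed
qed measurable

text \<open>Every exponent \<open>\<alpha> < L\<^sub>0 / 2\<close> is reached: \<open>G\<close> admits \<open>\<theta> L\<^sub>0 / 2\<close> for each \<open>\<theta> < 1\<close>, and multiplying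
  \<open>\<Gamma>\<close>, which admits \<open>1/4\<close>, by a small \<open>\<epsilon>\<^sub>r\<close> makes its exponent as large as needed.\<close>

lemma increment_ratio_sup_exp_integrable:
  fixes H :: "real ^ 'n"
  assumes fbf: "continuous_fbf M H W" and H: "\<And>k. 0 < H $ k \<and> H $ k < 1"
    and L\<^sub>0: "0 < L\<^sub>0" and \<delta>: "(\<delta> / sqrt (real CARD('n))) ^ CARD('n) \<le> exp (- L\<^sub>0)"
    and \<alpha>: "0 < \<alpha>" "2 * \<alpha> < L\<^sub>0"
  obtains c where "c \<in> borel_measurable M"
    and "AE \<omega> in M. increment_ratio_sup H (\<lambda>x. W x \<omega>) \<delta> \<le> ereal (c \<omega>)"
    and "integrable M (\<lambda>\<omega>. exp (\<alpha> * (c \<omega>)\<^sup>2))"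
proof -
  \<comment> \<open>\<open>\<theta>\<close> lies between \<open>\<rho> = 2 \<alpha> / L\<^sub>0\<close> and \<open>1\<close>, and \<open>\<eta>\<close> is chosen such that \<open>\<alpha> \<eta>\<^sup>2 = \<theta> L\<^sub>0 / 2\<close>.\<close>
  define \<rho> where "\<rho> = 2 * \<alpha> / L\<^sub>0"
  have \<rho>: "0 < \<rho>" "\<rho> < 1" using \<alpha> L\<^sub>0 by (auto simp: \<rho>_def)
  define \<theta> where "\<theta> = (1 + \<rho>) / 2"
  have \<theta>: "0 < \<theta>" "\<theta> < 1" "\<rho> < \<theta>" using \<rho> by (auto simp: \<theta>_def)
  define \<eta> where "\<eta> = sqrt (\<theta> / \<rho>)"
  have \<eta>: "1 < \<eta>" "\<eta>\<^sup>2 = \<theta> / \<rho>" using \<theta> \<rho> by (auto simp: \<eta>_def)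
  obtain \<epsilon> :: "nat \<Rightarrow> real" where \<epsilon>: "\<epsilon> \<longlonglongrightarrow> 0" "\<And>r. 0 \<le> \<epsilon> r"
    and main: "\<And>r f \<Gamma> G \<delta>. 1 \<le> r \<Longrightarrow> continuous_on UNIV f \<Longrightarrow> 0 \<le> \<Gamma> \<Longrightarrow> 0 \<le> G \<Longrightarrow>
      (\<And>p. p \<in> grid_index 0 \<Longrightarrow> \<bar>grid_increment H f 0 p\<bar> \<le> \<Gamma> * sqrt (max 1 (ln 2 * real (grid_level p)))) \<Longrightarrow>
      (\<And>p. p \<in> grid_index r \<Longrightarrow> (\<And>k. 1 / 2 ^ Suc (fst (p k)) < \<delta>) \<Longrightarrow>
        \<bar>grid_increment H f r p\<bar> \<le> G * sqrt (max L\<^sub>0 (ln 2 * real (grid_level p)))) \<Longrightarrow>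
      (\<And>x y :: real ^ 'n. (\<And>k. x $ k \<in> {0..1} \<and> y $ k \<in> {0..1}) \<Longrightarrow> norm (x - y) \<le> \<delta> \<Longrightarrow>
        (\<Prod>k\<in>UNIV. \<bar>x $ k - y $ k\<bar>) \<le> exp (- L\<^sub>0)) \<Longrightarrow>
      increment_ratio_sup H f \<delta> \<le> ereal (G + \<epsilon> r * \<Gamma>)"
    using increment_ratio_sup_grid_bound[OF H L\<^sub>0] by blast
  have "(\<lambda>r. \<alpha> * (\<eta> / (\<eta> - 1))\<^sup>2 * (\<epsilon> r)\<^sup>2) \<longlonglongrightarrow> \<alpha> * (\<eta> / (\<eta> - 1))\<^sup>2 * 0\<^sup>2"
    by (intro tendsto_intros \<epsilon>)
  then have "\<forall>\<^sub>F r in sequentially. \<alpha> * (\<eta> / (\<eta> - 1))\<^sup>2 * (\<epsilon> r)\<^sup>2 < 1 / 4"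
    by (intro order_tendstoD) auto
  then have "\<forall>\<^sub>F r in sequentially. \<alpha> * (\<eta> / (\<eta> - 1))\<^sup>2 * (\<epsilon> r)\<^sup>2 < 1 / 4 \<and> 1 \<le> r"
    using eventually_ge_at_top by (rule eventually_conj)
  then obtain r where r: "1 \<le> r" "\<alpha> * (\<eta> / (\<eta> - 1))\<^sup>2 * (\<epsilon> r)\<^sup>2 < 1 / 4"
    by (auto dest: eventually_happens)
  obtain G where G [measurable]: "G \<in> borel_measurable M" and G0: "\<And>\<omega>. 0 \<le> G \<omega>"
    and G_AE: "AE \<omega> in M. \<forall>p\<in>grid_index r. \<bar>grid_increment H (\<lambda>z. W z \<omega>) r p\<bar>
      \<le> G \<omega> * sqrt (max L\<^sub>0 (ln 2 * real (grid_level p)))"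
    and G_fin: "AE \<omega> in M. finite {p\<in>grid_index r. sqrt (2 * 3 / \<theta>) * sqrt (max L\<^sub>0 (ln 2 * real (grid_level p)))
      < \<bar>grid_increment H (\<lambda>z. W z \<omega>) r p\<bar>}"
    and G_int: "\<And>\<alpha>. 0 \<le> \<alpha> \<Longrightarrow> 2 * \<alpha> \<le> \<theta> * L\<^sub>0 \<Longrightarrow> integrable M (\<lambda>\<omega>. exp (\<alpha> * (G \<omega>)\<^sup>2))"
    by (rule grid_increment_bound[OF fbf conjunct1[OF H] L\<^sub>0 \<theta>(1,2), where r = r]) (rule that; (assumption | blast))
  have half: "0 < (1 / 2 :: real)" "(1 / 2 :: real) < 1" by simp_all
  obtain \<Gamma> where \<Gamma> [measurable]: "\<Gamma> \<in> borel_measurable M" and \<Gamma>0: "\<And>\<omega>. 0 \<le> \<Gamma> \<omega>"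
    and \<Gamma>_AE: "AE \<omega> in M. \<forall>p\<in>grid_index 0. \<bar>grid_increment H (\<lambda>z. W z \<omega>) 0 p\<bar>
      \<le> \<Gamma> \<omega> * sqrt (max 1 (ln 2 * real (grid_level p)))"
    and \<Gamma>_fin: "AE \<omega> in M. finite {p\<in>grid_index 0. sqrt (2 * 3 / (1 / 2)) * sqrt (max 1 (ln 2 * real (grid_level p)))
      < \<bar>grid_increment H (\<lambda>z. W z \<omega>) 0 p\<bar>}"
    and \<Gamma>_int: "\<And>\<alpha>. 0 \<le> \<alpha> \<Longrightarrow> 2 * \<alpha> \<le> 1 / 2 * 1 \<Longrightarrow> integrable M (\<lambda>\<omega>. exp (\<alpha> * (\<Gamma> \<omega>)\<^sup>2))"
    by (rule grid_increment_bound[OF fbf conjunct1[OF H] zero_less_one half, where r = 0]) (rule that; (assumption | blast))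
  show thesis
  proof (rule that)
    show "(\<lambda>\<omega>. G \<omega> + \<epsilon> r * \<Gamma> \<omega>) \<in> borel_measurable M" by measurable
    have cont: "AE \<omega> in M. continuous_on UNIV (\<lambda>x. W x \<omega>)"
      using fbf by (simp add: continuous_fbf_def)
    show "AE \<omega> in M. increment_ratio_sup H (\<lambda>x. W x \<omega>) \<delta> \<le> ereal (G \<omega> + \<epsilon> r * \<Gamma> \<omega>)"
      using cont G_AE \<Gamma>_AE
    proof eventually_elim
      case (elim \<omega>)
      show ?case
      proof (rule main[OF r(1) elim(1) \<Gamma>0 G0])
        show "(\<Prod>k\<in>UNIV. \<bar>x $ k - y $ k\<bar>) \<le> exp (- L\<^sub>0)" if "norm (x - y) \<le> \<delta>" for x y :: "real ^ 'n"
          using prod_le_of_norm_le[OF that] \<delta> by linarith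
      qed (use elim(2,3) in auto)
    qed
    show "integrable M (\<lambda>\<omega>. exp (\<alpha> * (G \<omega> + \<epsilon> r * \<Gamma> \<omega>)\<^sup>2))"
    proof (rule integrable_exp_square_sum[OF _ _ G0 _ _ \<eta>(1)])
      have "\<alpha> * \<eta>\<^sup>2 = \<theta> * L\<^sub>0 / 2"
        unfolding \<eta>(2) \<rho>_def using \<alpha> L\<^sub>0 by simp
      then show "integrable M (\<lambda>\<omega>. exp (\<alpha> * \<eta>\<^sup>2 * (G \<omega>)\<^sup>2))"
        using \<theta> L\<^sub>0 \<alpha>(1) by (intro G_int) auto
      have "integrable M (\<lambda>\<omega>. exp (\<alpha> * (\<eta> / (\<eta> - 1))\<^sup>2 * (\<epsilon> r)\<^sup>2 * (\<Gamma> \<omega>)\<^sup>2))"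
        using r(2) \<alpha>(1) by (intro \<Gamma>_int) auto
      then show "integrable M (\<lambda>\<omega>. exp (\<alpha> * (\<eta> / (\<eta> - 1))\<^sup>2 * (\<epsilon> r * \<Gamma> \<omega>)\<^sup>2))"
        by (simp add: power_mult_distrib mult.assoc)
    qed (use \<epsilon>(2) \<Gamma>0 \<alpha>(1) in auto)
  qed
qed

lemma mono_tendsto_at_right_0:
  fixes F :: "real \<Rightarrow> ereal"
  assumes mono: "\<And>\<delta> \<delta>'. \<delta> \<le> \<delta>' \<Longrightarrow> F \<delta> \<le> F \<delta>'"
  shows "(F \<longlongrightarrow> (INF \<delta>\<in>{0<..}. F \<delta>)) (at_right 0)"
proof (rule order_tendstoI)
  fix a assume "a < (INF \<delta>\<in>{0<..}. F \<delta>)"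
  then have "a < F \<delta>" if "0 < \<delta>" for \<delta>
    using that by (meson INF_lower greaterThan_iff order.strict_trans2)
  then show "\<forall>\<^sub>F \<delta> in at_right 0. a < F \<delta>"
    by (auto simp: eventually_at_right_field intro!: exI[of _ 1])
next
  fix a assume "(INF \<delta>\<in>{0<..}. F \<delta>) < a"
  then obtain \<delta> where "0 < \<delta>" "F \<delta> < a" by (auto simp: INF_less_iff)
  then have "F \<delta>' < a" if "\<delta>' < \<delta>" for \<delta>'
    using mono[of \<delta>' \<delta>] that by (meson less_imp_le order.strict_trans1)
  then show "\<forall>\<^sub>F \<delta> in at_right 0. F \<delta> < a"
    using \<open>0 < \<delta>\<close> by (auto simp: eventually_at_right_field intro!: exI[of _ \<delta>])
qed

text \<open>On almost every path all but finitely many grid boxes of each mesh \<open>r\<close> have normalised increment at most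
  \<open>sqrt 12 * sqrt L\<close> (\<open>t = 3\<close> and \<open>\<theta> = 1/2\<close> in the union bound), and for small \<open>\<delta>\<close> the exceptions are
  too large to matter. Choosing \<open>r\<close> after the path makes the rounding error smaller than \<open>1\<close>.\<close>

lemma increment_ratio_sup_limit:
  fixes H :: "real ^ 'n"
  assumes fbf: "continuous_fbf M H W" and H: "\<And>k. 0 < H $ k \<and> H $ k < 1"
  shows "AE \<omega> in M. \<exists>L. ((\<lambda>\<delta>. increment_ratio_sup H (\<lambda>x. W x \<omega>) \<delta>) \<longlongrightarrow> L) (at_right 0)
    \<and> L \<le> ereal (sqrt 12 + 1)"
proof -
  obtain \<epsilon> :: "nat \<Rightarrow> real" where \<epsilon>: "\<epsilon> \<longlonglongrightarrow> 0" "\<And>r. 0 \<le> \<epsilon> r"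
    and main: "\<And>r f \<Gamma> G \<delta>. 1 \<le> r \<Longrightarrow> continuous_on UNIV f \<Longrightarrow> 0 \<le> \<Gamma> \<Longrightarrow> 0 \<le> G \<Longrightarrow>
      (\<And>p. p \<in> grid_index 0 \<Longrightarrow> \<bar>grid_increment H f 0 p\<bar> \<le> \<Gamma> * sqrt (max 1 (ln 2 * real (grid_level p)))) \<Longrightarrow>
      (\<And>p. p \<in> grid_index r \<Longrightarrow> (\<And>k. 1 / 2 ^ Suc (fst (p k)) < \<delta>) \<Longrightarrow>
        \<bar>grid_increment H f r p\<bar> \<le> G * sqrt (max 1 (ln 2 * real (grid_level p)))) \<Longrightarrow>
      (\<And>x y :: real ^ 'n. (\<And>k. x $ k \<in> {0..1} \<and> y $ k \<in> {0..1}) \<Longrightarrow> norm (x - y) \<le> \<delta> \<Longrightarrow>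
        (\<Prod>k\<in>UNIV. \<bar>x $ k - y $ k\<bar>) \<le> exp (- 1)) \<Longrightarrow>
      increment_ratio_sup H f \<delta> \<le> ereal (G + \<epsilon> r * \<Gamma>)"
    using increment_ratio_sup_grid_bound[OF H zero_less_one] by blast
  have half: "0 < (1 / 2 :: real)" "(1 / 2 :: real) < 1" by simp_all
  obtain \<Gamma> where \<Gamma>: "\<Gamma> \<in> borel_measurable M" and \<Gamma>0: "\<And>\<omega>. 0 \<le> \<Gamma> \<omega>"
    and \<Gamma>_AE: "AE \<omega> in M. \<forall>p\<in>grid_index 0. \<bar>grid_increment H (\<lambda>z. W z \<omega>) 0 p\<bar>
      \<le> \<Gamma> \<omega> * sqrt (max 1 (ln 2 * real (grid_level p)))"
    and \<Gamma>_fin: "AE \<omega> in M. finite {p\<in>grid_index 0. sqrt (2 * 3 / (1 / 2)) * sqrt (max 1 (ln 2 * real (grid_level p)))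
      < \<bar>grid_increment H (\<lambda>z. W z \<omega>) 0 p\<bar>}"
    and \<Gamma>_int: "\<And>\<alpha>. 0 \<le> \<alpha> \<Longrightarrow> 2 * \<alpha> \<le> 1 / 2 * 1 \<Longrightarrow> integrable M (\<lambda>\<omega>. exp (\<alpha> * (\<Gamma> \<omega>)\<^sup>2))"
    by (rule grid_increment_bound[OF fbf conjunct1[OF H] zero_less_one half, where r = 0]) (rule that; (assumption | blast))
  have "AE \<omega> in M. finite {p\<in>grid_index r. sqrt 12 * sqrt (max 1 (ln 2 * real (grid_level p)))
      < \<bar>grid_increment H (\<lambda>z. W z \<omega>) r p\<bar>}" for r
    by (rule grid_increment_bound[OF fbf conjunct1[OF H] zero_less_one half, where r = r]) simp
  then have fin: "AE \<omega> in M. \<forall>r. finite {p\<in>grid_index r. sqrt 12 * sqrt (max 1 (ln 2 * real (grid_level p)))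
      < \<bar>grid_increment H (\<lambda>z. W z \<omega>) r p\<bar>}"
    by (simp add: AE_all_countable)
  have cont: "AE \<omega> in M. continuous_on UNIV (\<lambda>x. W x \<omega>)"
    using fbf by (simp add: continuous_fbf_def)
  show ?thesis
    using cont \<Gamma>_AE fin
  proof eventually_elim
    case (elim \<omega>)
    have "(\<lambda>r. \<epsilon> r * \<Gamma> \<omega>) \<longlonglongrightarrow> 0 * \<Gamma> \<omega>" by (intro tendsto_intros \<epsilon>)
    then have "\<forall>\<^sub>F r in sequentially. \<epsilon> r * \<Gamma> \<omega> < 1" by (intro order_tendstoD) auto
    then have "\<forall>\<^sub>F r in sequentially. \<epsilon> r * \<Gamma> \<omega> < 1 \<and> 1 \<le> r"
      using eventually_ge_at_top by (rule eventually_conj)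
    then obtain r where r: "1 \<le> r" "\<epsilon> r * \<Gamma> \<omega> < 1" by (auto dest: eventually_happens)
    define E where "E = {p\<in>grid_index r. sqrt 12 * sqrt (max 1 (ln 2 * real (grid_level p)))
      < \<bar>grid_increment H (\<lambda>z. W z \<omega>) r p\<bar>}"
    have "finite ((\<lambda>p. fst (p undefined)) ` E)" using elim(3) by (simp add: E_def)
    then obtain N where N: "\<And>p. p \<in> E \<Longrightarrow> fst (p undefined) \<le> N"
      by (auto simp: finite_nat_set_iff_bounded_le)
    \<comment> \<open>Boxes with all sides below \<open>\<delta>\<^sub>0\<close> have scale larger than \<open>N\<close> in every coordinate, hence avoid \<open>E\<close>;
      one coordinate (here \<open>undefined\<close>) is enough to see this.\<close>
    define \<delta>\<^sub>0 :: real where "\<delta>\<^sub>0 = min (exp (- 1)) (1 / 2 ^ Suc N)"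
    have \<delta>\<^sub>0: "0 < \<delta>\<^sub>0" by (simp add: \<delta>\<^sub>0_def)
    have "increment_ratio_sup H (\<lambda>x. W x \<omega>) \<delta>\<^sub>0 \<le> ereal (sqrt 12 + \<epsilon> r * \<Gamma> \<omega>)"
    proof (rule main[OF r(1) elim(1) \<Gamma>0])
      show "0 \<le> sqrt 12" by simp
      fix p :: "'n \<Rightarrow> nat \<times> nat \<times> nat"
      assume p: "p \<in> grid_index r" and small: "\<And>k. 1 / 2 ^ Suc (fst (p k)) < \<delta>\<^sub>0"
      have "p \<notin> E"
      proof
        assume "p \<in> E"
        then have "(1::real) / 2 ^ Suc N \<le> 1 / 2 ^ Suc (fst (p undefined))"
          using N by (intro divide_left_mono power_increasing) auto
        also have "\<dots> < \<delta>\<^sub>0" by (rule small)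
        finally show False by (simp add: \<delta>\<^sub>0_def)
      qed
      then show "\<bar>grid_increment H (\<lambda>z. W z \<omega>) r p\<bar> \<le> sqrt 12 * sqrt (max 1 (ln 2 * real (grid_level p)))"
        using p by (simp add: E_def)
    next
      fix x y :: "real ^ 'n"
      assume unit: "\<And>k. x $ k \<in> {0..1} \<and> y $ k \<in> {0..1}" and norm: "norm (x - y) \<le> \<delta>\<^sub>0"
      have "\<bar>x $ k - y $ k\<bar> \<le> 1" for k using unit[of k] by auto
      then have "(\<Prod>k\<in>UNIV - {undefined}. \<bar>x $ k - y $ k\<bar>) \<le> 1" by (intro prod_le_1) auto
      moreover have "\<bar>x $ undefined - y $ undefined\<bar> \<le> exp (- 1)"
      proof -
        have "\<bar>(x - y) $ undefined\<bar> \<le> norm (x - y)" by (rule component_le_norm_cart)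
        then show ?thesis using norm by (simp add: \<delta>\<^sub>0_def)
      qed
      ultimately have "\<bar>x $ undefined - y $ undefined\<bar> * (\<Prod>k\<in>UNIV - {undefined}. \<bar>x $ k - y $ k\<bar>) \<le> exp (- 1) * 1"
        by (intro mult_mono) (auto intro: prod_nonneg)
      then show "(\<Prod>k\<in>UNIV. \<bar>x $ k - y $ k\<bar>) \<le> exp (- 1)"
        by (subst prod.remove[of _ undefined]) auto
    qed (use elim(2) in auto)
    also have "\<dots> \<le> ereal (sqrt 12 + 1)" using r(2) by simp
    finally have "(INF \<delta>\<in>{0<..}. increment_ratio_sup H (\<lambda>x. W x \<omega>) \<delta>) \<le> ereal (sqrt 12 + 1)"
      using \<delta>\<^sub>0 by (meson INF_lower greaterThan_iff order_trans)
    then show ?case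
      using mono_tendsto_at_right_0[of "increment_ratio_sup H (\<lambda>x. W x \<omega>)", OF increment_ratio_sup_mono]
      by blast
  qed
qed

theorem corollary4p5:
  "\<exists>\<kappa>::real. \<forall>(M :: 'a measure) (H :: real ^ 'n) (W :: real ^ 'n \<Rightarrow> 'a \<Rightarrow> real).
     (\<forall>k. 0 < H $ k \<and> H $ k < 1) \<longrightarrow> continuous_fbf M H W \<longrightarrow>
       (\<forall>\<delta>>0. \<delta> < sqrt (real CARD('n)) \<longrightarrow>
          (\<exists>c \<in> borel_measurable M.
             (AE \<omega> in M. increment_ratio_sup H (\<lambda>x. W x \<omega>) \<delta> \<le> ereal (c \<omega>)) \<and>
             (\<exists>\<alpha>>0. integrable M (\<lambda>\<omega>. exp (\<alpha> * (c \<omega>)\<^sup>2))) \<and>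
             ((\<delta> / sqrt (real CARD('n))) ^ CARD('n) < exp (- 2) \<longrightarrow>
                integrable M (\<lambda>\<omega>. exp ((c \<omega>)\<^sup>2))))) \<and>
       (AE \<omega> in M. \<exists>L. ((\<lambda>\<delta>. increment_ratio_sup H (\<lambda>x. W x \<omega>) \<delta>) \<longlongrightarrow> L) (at_right 0)
                      \<and> L \<le> ereal \<kappa>)"
proof (intro exI[of _ "sqrt 12 + 1"] allI impI conjI)
  fix M :: "'a measure" and H :: "real ^ 'n" and W :: "real ^ 'n \<Rightarrow> 'a \<Rightarrow> real"
  assume "\<forall>k. 0 < H $ k \<and> H $ k < 1" and fbf: "continuous_fbf M H W"
  then have H: "0 < H $ k \<and> H $ k < 1" for k by blast
  show "AE \<omega> in M. \<exists>L. ((\<lambda>\<delta>. increment_ratio_sup H (\<lambda>x. W x \<omega>) \<delta>) \<longlongrightarrow> L) (at_right 0)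
      \<and> L \<le> ereal (sqrt 12 + 1)"
    by (rule increment_ratio_sup_limit[OF fbf H])
  fix \<delta> :: real assume \<delta>: "0 < \<delta>" "\<delta> < sqrt (real CARD('n))"
  define P where "P = (\<delta> / sqrt (real CARD('n))) ^ CARD('n)"
  have P: "0 < P" "P < 1" using \<delta> by (auto simp: P_def power_less_one_iff)
  define L\<^sub>0 where "L\<^sub>0 = - ln P"
  have L\<^sub>0: "0 < L\<^sub>0" "P = exp (- L\<^sub>0)" using P by (auto simp: L\<^sub>0_def)
  \<comment> \<open>The hypothesis \<open>P < exp (- 2)\<close> says \<open>L\<^sub>0 > 2\<close>, so that \<open>1 < L\<^sub>0 / 2\<close>.\<close>
  define \<alpha> where "\<alpha> = (if P < exp (- 2) then 1 else L\<^sub>0 / 4)"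
  have \<alpha>: "0 < \<alpha>" "2 * \<alpha> < L\<^sub>0" using L\<^sub>0 by (auto simp: \<alpha>_def)
  obtain c where c: "c \<in> borel_measurable M"
    "AE \<omega> in M. increment_ratio_sup H (\<lambda>x. W x \<omega>) \<delta> \<le> ereal (c \<omega>)"
    "integrable M (\<lambda>\<omega>. exp (\<alpha> * (c \<omega>)\<^sup>2))"
    using increment_ratio_sup_exp_integrable[OF fbf H L\<^sub>0(1) _ \<alpha>, of \<delta>] L\<^sub>0(2) P_def by auto
  then show "\<exists>c \<in> borel_measurable M.
      (AE \<omega> in M. increment_ratio_sup H (\<lambda>x. W x \<omega>) \<delta> \<le> ereal (c \<omega>)) \<and>
      (\<exists>\<alpha>>0. integrable M (\<lambda>\<omega>. exp (\<alpha> * (c \<omega>)\<^sup>2))) \<and>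
      ((\<delta> / sqrt (real CARD('n))) ^ CARD('n) < exp (- 2) \<longrightarrow> integrable M (\<lambda>\<omega>. exp ((c \<omega>)\<^sup>2)))"
    using \<alpha>(1) by (intro bexI[of _ c]) (auto simp: P_def[symmetric] \<alpha>_def)
qed

end
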